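(* Let $L\colon[a,b]\times\mathbb{R}^n\times\mathbb{R}^n\to\mathbb{R}$ be continuous and satisfy the strict convexity condition (SC) stated in the context. Let $v=(v_1,\dots,v_n)\in W^{1,1}((a,b);\mathbb{R}^n)$ be a minimizer of $\mathscr{L}$ over $\mathscr{A}_{v(a),v(b)}$, and let $t\in[a,b]$. (i) If $t\in(a,b]$, $D^-v_1(t)$ exists as an infinite value, and $v_j$ is Lipschitz in a left-neighbourhood of $t$ for each $2\le j\le n$, then for all $m>0$, \[ \lim_{s\uparrow t}(t-s)^{-1}\lambda\big(\{r\in(s,t):|v_1'(r)|\le m\}\big)=0 . \] (ii) If $t\in[a,b)$, $D^+v_1(t)$ exists as an infinite value, and $v_j$ is Lipschitz in a right-neighbourhood of $t$ for each $2\le j\le n$, then for all $m>0$, \[ \lim_{s\downarrow t}(s-t)^{-1}\lambda\big(\{r\in(t,s):|v_1'(r)|\le m\}\big)=0 . \]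
   Context: $[a,b]\subseteq\mathbb{R}$, $n\ge1$, $\|\cdot\|$ is the Euclidean norm on $\mathbb{R}^n$, $\lambda$ is Lebesgue measure. Functions in $W^{1,1}((a,b);\mathbb{R}^n)$ are identified with their absolutely continuous representatives on $[a,b]$. $\mathscr{L}(u)=\int_a^bL(t,u(t),u'(t))\,dt$; $\mathscr{A}_{A,B}=\{u\in W^{1,1}((a,b);\mathbb{R}^n):u(a)=A,\ u(b)=B\}$; a minimizer of $\mathscr{L}$ over $\mathscr{A}_{v(a),v(b)}$ is $v$ with $\mathscr{L}(v)\le\mathscr{L}(u)$ for all $u\in\mathscr{A}_{v(a),v(b)}$. Condition (SC): for all $R\in[1,\infty)$ there exists $\tau_R>0$ such that for all $(t,y,p)\in[a,b]\times\mathbb{R}^n\times\mathbb{R}^n$ with $\max\{|t|,\|y\|,\|p\|\}\le R+1$ there exists a subdifferential (subgradient) $\xi\in\mathbb{R}^n$ of $L(t,y,\cdot)$ at $p$ (i.e. $L(t,y,q)\ge L(t,y,p)+\xi\cdot(q-p)$ for all $q\in\mathbb{R}^n$) such that $L(t,y,q)\ge L(t,y,p)+\xi\cdot(q-p)+2\tau_R$ whenever $\|q-p\|\ge R^{-1}$. One-sided derivatives of a scalar function: $D^-v_1(t)=\lim_{s\uparrow t}\frac{v_1(s)-v_1(t)}{s-t}$ and $D^+v_1(t)=\lim_{s\downarrow t}\frac{v_1(s)-v_1(t)}{s-t}$, whenever these limits make sense and exist as finite or infinite values. It is not assumed that the one-sided derivatives of $v_j$, $2\le j\le n$, exist at $t$.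 *)

theory Defs
  imports "HOL-Analysis.Analysis"
begin

definition abs_continuous_on_interval :: "real \<Rightarrow> real \<Rightarrow> (real \<Rightarrow> 'a::real_normed_vector) \<Rightarrow> bool" where
  "abs_continuous_on_interval a b u \<longleftrightarrow>
     (\<forall>\<epsilon>>0. \<exists>\<delta>>0. \<forall>D :: (real \<times> real) set.
        finite D \<longrightarrow> (\<forall>(c, d)\<in>D. a \<le> c \<and> c \<le> d \<and> d \<le> b) \<longrightarrow>
        disjoint_family_on (\<lambda>(c, d). {c<..<d}) D \<longrightarrow>
        (\<Sum>(c, d)\<in>D. d - c) < \<delta> \<longrightarrow>
        (\<Sum>(c, d)\<in>D. norm (u d - u c)) < \<epsilon>)"

text \<open>Elements of the Sobolev space \<open>W\<^sup>1\<^sup>,\<^sup>1((a,b))\<close> are represented by their absolutely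
  continuous representatives on \<open>[a,b]\<close>; values of functions outside \<open>[a,b]\<close> are irrelevant.\<close>

definition admissible :: "real \<Rightarrow> real \<Rightarrow> 'a::real_normed_vector \<Rightarrow> 'a \<Rightarrow> (real \<Rightarrow> 'a) set" where
  "admissible a b A B = {u. abs_continuous_on_interval a b u \<and> u a = A \<and> u b = B}"

text \<open>The integral is extended-real valued: it may be \<open>+\<infinity>\<close> for some competitors. When \<open>L\<close> is
  continuous and convex in its last argument, the negative part has a finite integral for
  absolutely continuous \<open>u\<close>, so the difference below is never of the form \<open>\<infinity> - \<infinity>\<close>.
  An absolutely continuous \<open>u\<close> is differentiable almost everywhere, so the unspecified value of
  \<open>vector_derivative\<close> elsewhere does not matter; using \<open>lebesgue\<close> (which is complete) rather
  than \<open>lborel\<close> keeps the integrand measurable.\<close>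

definition action ::
  "(real \<times> 'a::real_normed_vector \<times> 'a \<Rightarrow> real) \<Rightarrow> real \<Rightarrow> real \<Rightarrow> (real \<Rightarrow> 'a) \<Rightarrow> ereal" where
  "action L a b u =
     enn2ereal (\<integral>\<^sup>+t\<in>{a<..<b}. ennreal (L (t, u t, vector_derivative u (at t))) \<partial>lebesgue) -
     enn2ereal (\<integral>\<^sup>+t\<in>{a<..<b}. ennreal (- L (t, u t, vector_derivative u (at t))) \<partial>lebesgue)"

definition is_minimizer ::
  "(real \<times> 'a::real_normed_vector \<times> 'a \<Rightarrow> real) \<Rightarrow> real \<Rightarrow> real \<Rightarrow> (real \<Rightarrow> 'a) \<Rightarrow> bool" where
  "is_minimizer L a b v \<longleftrightarrow>
     v \<in> admissible a b (v a) (v b) \<and>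
     (\<forall>u\<in>admissible a b (v a) (v b). action L a b v \<le> action L a b u)"

definition is_subgradient :: "('a::real_inner \<Rightarrow> real) \<Rightarrow> 'a \<Rightarrow> 'a \<Rightarrow> bool" where
  "is_subgradient f p \<xi> \<longleftrightarrow> (\<forall>q. f q \<ge> f p + \<xi> \<bullet> (q - p))"

definition strict_convexity_SC ::
  "real \<Rightarrow> real \<Rightarrow> (real \<times> 'a::real_inner \<times> 'a \<Rightarrow> real) \<Rightarrow> bool" where
  "strict_convexity_SC a b L \<longleftrightarrow>
     (\<forall>R\<ge>1. \<exists>\<tau>>0. \<forall>t\<in>{a..b}. \<forall>y p.
        max \<bar>t\<bar> (max (norm y) (norm p)) \<le> R + 1 \<longrightarrow>
        (\<exists>\<xi>. is_subgradient (\<lambda>q. L (t, y, q)) p \<xi> \<and>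
             (\<forall>q. norm (q - p) \<ge> inverse R \<longrightarrow>
                  L (t, y, q) \<ge> L (t, y, p) + \<xi> \<bullet> (q - p) + 2 * \<tau>)))"

definition has_left_derivative :: "(real \<Rightarrow> real) \<Rightarrow> ereal \<Rightarrow> real \<Rightarrow> bool" where
  "has_left_derivative f D t \<longleftrightarrow> ((\<lambda>s. ereal ((f s - f t) / (s - t))) \<longlongrightarrow> D) (at_left t)"

definition has_right_derivative :: "(real \<Rightarrow> real) \<Rightarrow> ereal \<Rightarrow> real \<Rightarrow> bool" where
  "has_right_derivative f D t \<longleftrightarrow> ((\<lambda>s. ereal ((f s - f t) / (s - t))) \<longlongrightarrow> D) (at_right t)"

definition lipschitz_left_near :: "real \<Rightarrow> real \<Rightarrow> (real \<Rightarrow> real) \<Rightarrow> real \<Rightarrow> bool" where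
  "lipschitz_left_near a b f t \<longleftrightarrow> (\<exists>\<delta>>0. \<exists>C. C-lipschitz_on ({t - \<delta>..t} \<inter> {a..b}) f)"

definition lipschitz_right_near :: "real \<Rightarrow> real \<Rightarrow> (real \<Rightarrow> real) \<Rightarrow> real \<Rightarrow> bool" where
  "lipschitz_right_near a b f t \<longleftrightarrow> (\<exists>\<delta>>0. \<exists>C. C-lipschitz_on ({t..t + \<delta>} \<inter> {a..b}) f)"

end

theory Submission
  imports Defs
begin

text \<open>Suppose the \<open>k\<close>-th component \<open>v\<^sub>k\<close> has an infinite one-sided derivative at \<open>t\<close> while its velocity
stays in \<open>[-m, m]\<close> on a set \<open>E\<close>. The graph of \<open>v\<^sub>k\<close> then climbs steeply on average, but on \<open>E\<close> it is
slow, so the trajectory mixes slow and very fast pieces. Strict convexity makes such a mixture more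
expensive than constant velocity, and a minimizer cannot afford it on a set of positive density.

Energies of velocities that are not bounded cannot be compared at nearby points, since \<open>L\<close> is only
continuous. The comparison is therefore always made with competitors of bounded slope: on an
interval \<open>[c, d]\<close> near \<open>t\<close> the minimizer is replaced by the affine function with the same end
points, and only intervals with mean velocity \<open>p\<close> of norm at most a fixed \<open>R\<close> are used. Let \<open>\<xi>\<close> be the
subgradient at \<open>p\<close> of \<open>L\<close> frozen at \<open>(t, v t)\<close>. Convexity carries the strict gap \<open>2 \<tau>\<close> over to the
nearby points \<open>(s, v s)\<close>, for all velocities at once, with an error \<open>\<epsilon>\<close> that is uniform in the velocity
(\<open>gap_stable_under_perturbation\<close>). The linear term \<open>\<xi> \<bullet> (v' - p)\<close> has integral zero over
\<open>[c, d]\<close>, so minimality leaves \<open>\<tau> * |{s \<in> (c, d). |v' s - p| \<ge> 1}| \<le> \<epsilon> * (d - c)\<close>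
(\<open>minimizer_velocity_near_mean\<close>): a minimizer has velocity close to its mean on most of the interval.

It remains to cover \<open>E\<close> by such intervals. Subtract from \<open>v\<^sub>k\<close> the line of slope \<open>m + 1\<close> through
\<open>(t, v\<^sub>k t)\<close>. The result \<open>h\<close> is larger at \<open>s\<close> than at \<open>t\<close>, because the derivative at \<open>t\<close> is infinite,
and it decreases at every point of \<open>E\<close>. So each point of \<open>E\<close> lies in the shadow of an earlier,
higher point. Intervals with \<open>h c = h d\<close> are those on which \<open>v\<^sub>k\<close> has mean slope \<open>m + 1\<close>, the other
components are Lipschitz, and so the mean velocity is bounded while \<open>E\<close> is at distance at least \<open>1\<close>
from it. A version of the rising sun lemma (\<open>shadow_measure_le\<close>) adds up the estimates
\<open>|E \<inter> (c, d)| \<le> \<eta> * (d - c)\<close> to \<open>|E \<inter> (t, s)| \<le> \<eta> * (s - t)\<close>, with \<open>\<eta>\<close> as small as desired.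

The argument needs the fundamental theorem of calculus for absolutely continuous functions. After
reduction to monotone functions by means of the variation, Fatou's lemma bounds the integral of a
lower derivative \<open>f\<close> from above by the increment, and a continuous induction that steps over the
exceptional null set inside a small open set gives the converse bound. Hence the function is the
integral of \<open>f\<close> and Lebesgue's differentiation theorem applies to it.\<close>

section \<open>Variation of absolutely continuous functions\<close>

text \<open>The set \<open>U\<close> restricts where the intervals may lie, so that the variation over a small open set can be
formed. Intervals of length zero are admitted because cutting a family at a point produces them.\<close>
definition intervals_in :: "real set \<Rightarrow> real \<Rightarrow> real \<Rightarrow> (real \<times> real) set \<Rightarrow> bool" where
  "intervals_in U x y D \<longleftrightarrow> finite D \<and> disjoint_family_on (\<lambda>(c, d). {c<..<d}) D \<and>
     (\<forall>(c, d)\<in>D. x \<le> c \<and> c \<le> d \<and> d \<le> y \<and> {c<..<d} \<subseteq> U)"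

definition osc_sum :: "(real \<Rightarrow> 'a::real_normed_vector) \<Rightarrow> (real \<times> real) set \<Rightarrow> real" where
  "osc_sum w D = (\<Sum>(c, d)\<in>D. norm (w d - w c))"

lemma intervals_in_same:
  assumes D: "intervals_in U x y D" and "(c, d) \<in> D" "(c', d') \<in> D" "(c, d) \<noteq> (c', d')"
  shows "d \<le> c' \<or> d' \<le> c \<or> c = d \<or> c' = d'"
proof (rule ccontr)
  assume n: "\<not> ?thesis"
  have "c \<le> d" "c' \<le> d'" using assms by (auto simp: intervals_in_def)
  then have "max c c' < min d d'" using n by auto
  then have "(max c c' + min d d') / 2 \<in> {c<..<d} \<inter> {c'<..<d'}" by auto
  moreover have "{c<..<d} \<inter> {c'<..<d'} = {}"
    using disjoint_family_onD[of "\<lambda>(c, d). {c<..<d}" D, OF _ assms(2-4)] D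
    by (simp only: prod.case intervals_in_def)
  ultimately show False by blast
qed

text \<open>Monotone maps such as \<open>\<lambda>t. min t y\<close> can send several intervals to the same degenerate one. These
contribute nothing to the oscillation, so no term of the sum is lost by passing to the image.\<close>
lemma intervals_in_map:
  fixes w :: "real \<Rightarrow> 'a::real_normed_vector"
  assumes D: "intervals_in U x y D" and h: "mono h"
    and h': "\<And>c d. (c, d) \<in> D \<Longrightarrow> x' \<le> h c \<and> h d \<le> y' \<and> {h c<..<h d} \<subseteq> U'"
  defines "D' \<equiv> (\<lambda>(c, d). (h c, h d)) ` D"
  shows "intervals_in U' x' y' D'" and "osc_sum w D' = osc_sum (w \<circ> h) D"
proof -
  have fin: "finite D" using D by (simp add: intervals_in_def)
  have ord: "h d \<le> h c' \<or> h d' \<le> h c \<or> h c = h d \<or> h c' = h d'"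
    if "(c, d) \<in> D" "(c', d') \<in> D" "(c, d) \<noteq> (c', d')" for c d c' d'
    using intervals_in_same[OF D that] monoD[OF h] by metis
  have le: "c \<le> d" if "(c, d) \<in> D" for c d using D that by (auto simp: intervals_in_def)
  show "intervals_in U' x' y' D'"
    unfolding intervals_in_def
  proof (intro conjI)
    show "finite D'" using fin by (simp add: D'_def)
    show "\<forall>(c, d)\<in>D'. x' \<le> c \<and> c \<le> d \<and> d \<le> y' \<and> {c<..<d} \<subseteq> U'"
      using h' le monoD[OF h] by (fastforce simp: D'_def)
    show "disjoint_family_on (\<lambda>(c, d). {c<..<d}) D'"
      unfolding disjoint_family_on_def D'_def
      using ord by (fastforce simp: disjoint_iff)
  qed
  have "osc_sum w D' = sum ((\<lambda>(c, d). norm (w d - w c)) \<circ> (\<lambda>(c, d). (h c, h d))) D"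
    unfolding osc_sum_def D'_def
  proof (rule sum.reindex_nontrivial[OF fin])
    fix p q assume "p \<in> D" "q \<in> D" "p \<noteq> q" and eq: "(case p of (c, d) \<Rightarrow> (h c, h d)) = (case q of (c, d) \<Rightarrow> (h c, h d))"
    moreover obtain c d c' d' where "p = (c, d)" "q = (c', d')" by fastforce
    ultimately have "h c = h d" using ord[of c d c' d'] le[of c d] le[of c' d'] monoD[OF h, of c d] by auto
    then show "(\<lambda>(c, d). norm (w d - w c)) (case p of (c, d) \<Rightarrow> (h c, h d)) = 0"
      using \<open>p = (c, d)\<close> by simp
  qed
  then show "osc_sum w D' = osc_sum (w \<circ> h) D"
    by (simp add: osc_sum_def case_prod_unfold)
qed

lemma sum_lengths_le_measure:
  assumes D: "intervals_in U x y D" and U: "U \<in> lmeasurable"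
  shows "(\<Sum>(c, d)\<in>D. d - c) \<le> measure lebesgue U"
proof -
  have fin: "finite D" and le: "\<And>c d. (c, d) \<in> D \<Longrightarrow> c \<le> d"
    and sub: "\<And>c d. (c, d) \<in> D \<Longrightarrow> {c<..<d} \<subseteq> U"
    and disj: "disjoint_family_on (\<lambda>(c, d). {c<..<d}) D"
    using D by (auto simp: intervals_in_def)
  have "(\<Sum>(c, d)\<in>D. d - c) = (\<Sum>p\<in>D. measure lebesgue ((\<lambda>(c, d). {c<..<d}) p))"
    using le by (intro sum.cong) auto
  also have "\<dots> = measure lebesgue (\<Union>p\<in>D. (\<lambda>(c, d). {c<..<d}) p)"
    by (rule measure_finite_Union[symmetric, OF fin _ disj]) (auto dest!: le)
  also have "\<dots> \<le> measure lebesgue U"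
    by (rule measure_mono_fmeasurable) (use U sub fin in \<open>auto intro!: sets.finite_UN\<close>)
  finally show ?thesis .
qed

lemma abs_continuous_on_intervalD:
  assumes "abs_continuous_on_interval a b w" "0 < \<epsilon>"
  obtains \<delta> where "0 < \<delta>"
    "\<And>D U. \<lbrakk>intervals_in U a b D; (\<Sum>(c, d)\<in>D. d - c) < \<delta>\<rbrakk> \<Longrightarrow> osc_sum w D < \<epsilon>"
proof -
  obtain \<delta> where \<delta>: "0 < \<delta>" "\<And>D. \<lbrakk>finite D; \<forall>(c, d)\<in>D. a \<le> c \<and> c \<le> d \<and> d \<le> b; disjoint_family_on (\<lambda>(c, d). {c<..<d}) D;
     (\<Sum>(c, d)\<in>D. d - c) < \<delta>\<rbrakk> \<Longrightarrow> (\<Sum>(c, d)\<in>D. norm (w d - w c)) < \<epsilon>"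
    using assms unfolding abs_continuous_on_interval_def by meson
  show thesis
  proof (rule that[OF \<delta>(1)])
    fix D U assume "intervals_in U a b D" "(\<Sum>(c, d)\<in>D. d - c) < \<delta>"
    then show "osc_sum w D < \<epsilon>" unfolding osc_sum_def
      by (intro \<delta>(2)) (auto simp: intervals_in_def)
  qed
qed

definition variation :: "(real \<Rightarrow> 'a::real_normed_vector) \<Rightarrow> real set \<Rightarrow> real \<Rightarrow> real \<Rightarrow> real" where
  "variation w U x y = Sup (osc_sum w ` {D. intervals_in U x y D})"

lemma intervals_in_mono:
  assumes "intervals_in U x y D" "U \<subseteq> U'" "x' \<le> x" "y \<le> y'"
  shows "intervals_in U' x' y' D"
  using assms unfolding intervals_in_def by fastforce

lemma osc_sum_Un:
  assumes D: "intervals_in U x y D" and D': "intervals_in U' y z D'"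
  shows "osc_sum w (D \<union> D') = osc_sum w D + osc_sum w D'"
proof -
  have fin: "finite D" "finite D'" using assms by (auto simp: intervals_in_def)
  have eq: "c = d" if "(c, d) \<in> D \<inter> D'" for c d
    using D D' that by (fastforce simp: intervals_in_def)
  have "(\<Sum>(c, d)\<in>D \<inter> D'. norm (w d - w c)) = 0"
    by (intro sum.neutral) (use eq in fastforce)
  then show ?thesis
    unfolding osc_sum_def using sum.union_inter[OF fin, of "\<lambda>(c, d). norm (w d - w c)"] by simp
qed

lemma intervals_in_Un:
  assumes D: "intervals_in U x y D" and D': "intervals_in U y z D'" and "x \<le> y" "y \<le> z"
  shows "intervals_in U x z (D \<union> D')"
proof -
  have b: "x \<le> c \<and> c \<le> d \<and> d \<le> y \<and> {c<..<d} \<subseteq> U" if "(c, d) \<in> D" for c d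
    using D that by (auto simp: intervals_in_def)
  have b': "y \<le> c \<and> c \<le> d \<and> d \<le> z \<and> {c<..<d} \<subseteq> U" if "(c, d) \<in> D'" for c d
    using D' that by (auto simp: intervals_in_def)
  have "disjoint_family_on (\<lambda>(c, d). {c<..<d}) (D \<union> D')"
    unfolding disjoint_family_on_def
  proof (intro ballI impI)
    fix p q assume pq: "p \<in> D \<union> D'" "q \<in> D \<union> D'" "p \<noteq> q"
    obtain c d c' d' where e: "p = (c, d)" "q = (c', d')" by fastforce
    have "disjoint_family_on (\<lambda>(c, d). {c<..<d}) D" "disjoint_family_on (\<lambda>(c, d). {c<..<d}) D'"
      using D D' by (auto simp: intervals_in_def)
    then consider "p \<in> D" "q \<in> D'" | "p \<in> D'" "q \<in> D" | "{c<..<d} \<inter> {c'<..<d'} = {}"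
      using pq e unfolding disjoint_family_on_def by (smt (verit, best) UnE case_prod_conv)
    then have "{c<..<d} \<inter> {c'<..<d'} = {}"
    proof cases
      case 1 then show ?thesis using b[of c d] b'[of c' d'] e by (auto simp: disjoint_iff)
    next
      case 2 then show ?thesis using b[of c' d'] b'[of c d] e by (auto simp: disjoint_iff)
    qed
    then show "(case p of (c, d) \<Rightarrow> {c<..<d}) \<inter> (case q of (c, d) \<Rightarrow> {c<..<d}) = {}" using e by simp
  qed
  moreover have "x \<le> c \<and> c \<le> d \<and> d \<le> z \<and> {c<..<d} \<subseteq> U" if "(c, d) \<in> D \<union> D'" for c d
    using that b[of c d] b'[of c d] assms(3,4) by (metis UnE order_trans)
  moreover have "finite (D \<union> D')" using D D' by (simp add: intervals_in_def)
  ultimately show ?thesis unfolding intervals_in_def by blast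
qed

lemma intervals_in_empty [simp]: "intervals_in U x y {}"
  by (auto simp: intervals_in_def disjoint_family_on_def)

lemma intervals_in_single: "\<lbrakk>x \<le> c; c \<le> d; d \<le> y; {c<..<d} \<subseteq> U\<rbrakk> \<Longrightarrow> intervals_in U x y {(c, d)}"
  by (auto simp: intervals_in_def disjoint_family_on_def)

lemma intervals_in_split:
  fixes w :: "real \<Rightarrow> 'a::real_normed_vector"
  assumes D: "intervals_in UNIV x z D" and "x \<le> y" "y \<le> z"
  obtains D1 D2 where "intervals_in UNIV x y D1" "intervals_in UNIV y z D2"
    "osc_sum w D \<le> osc_sum w D1 + osc_sum w D2"
proof -
  have b: "x \<le> c \<and> c \<le> d \<and> d \<le> z" if "(c, d) \<in> D" for c d
    using D that by (auto simp: intervals_in_def)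
  have m: "mono (\<lambda>t. min t y)" "mono (\<lambda>t. max t y)" by (auto simp: mono_def)
  let ?D1 = "(\<lambda>(c, d). (min c y, min d y)) ` D" and ?D2 = "(\<lambda>(c, d). (max c y, max d y)) ` D"
  have h1: "x \<le> min c y \<and> min d y \<le> y \<and> {min c y<..<min d y} \<subseteq> UNIV"
    and h2: "y \<le> max c y \<and> max d y \<le> z \<and> {max c y<..<max d y} \<subseteq> UNIV" if "(c, d) \<in> D" for c d
    using b[OF that] assms by auto
  show thesis
  proof (rule that)
    show "intervals_in UNIV x y ?D1" by (rule intervals_in_map(1)[OF D m(1) h1])
    show "intervals_in UNIV y z ?D2" by (rule intervals_in_map(1)[OF D m(2) h2])
    have "osc_sum w D \<le> osc_sum (w \<circ> (\<lambda>t. min t y)) D + osc_sum (w \<circ> (\<lambda>t. max t y)) D"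
      unfolding osc_sum_def sum.distrib[symmetric]
    proof (rule sum_mono, clarsimp)
      fix c d assume "(c, d) \<in> D"
      then have "c \<le> d" using b by auto
      then consider "d \<le> y" | "y \<le> c" | "c < y" "y < d" by linarith
      then show "norm (w d - w c) \<le> norm (w (min d y) - w (min c y)) + norm (w (max d y) - w (max c y))"
      proof cases
        case 3
        then show ?thesis using norm_triangle_ineq[of "w y - w c" "w d - w y"] by (simp add: min_def max_def)
      qed (use \<open>c \<le> d\<close> in \<open>auto simp: min_def max_def\<close>)
    qed
    also have "\<dots> = osc_sum w ?D1 + osc_sum w ?D2"
      using intervals_in_map(2)[OF D m(1) h1, of w] intervals_in_map(2)[OF D m(2) h2, of w] by simp
    finally show "osc_sum w D \<le> osc_sum w ?D1 + osc_sum w ?D2" .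
  qed
qed

text \<open>The interval is cut into finitely many pieces shorter than the \<open>\<delta>\<close> that belongs to \<open>\<epsilon> = 1\<close>. Every
family of intervals, cut in the same way, has oscillation at most \<open>1\<close> on each piece.\<close>
lemma osc_sum_bounded:
  assumes ac: "abs_continuous_on_interval a b w" and "a \<le> b"
  obtains M where "\<And>D U. intervals_in U a b D \<Longrightarrow> osc_sum w D \<le> M"
proof -
  obtain \<delta> where \<delta>: "0 < \<delta>" "\<And>D U. \<lbrakk>intervals_in U a b D; (\<Sum>(c, d)\<in>D. d - c) < \<delta>\<rbrakk> \<Longrightarrow> osc_sum w D < 1"
    using abs_continuous_on_intervalD[OF ac zero_less_one] by blast
  have step: "osc_sum w D \<le> 1" if "intervals_in UNIV x y D" "a \<le> x" "x \<le> y" "y \<le> b" "y - x < \<delta>" for x y D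
  proof -
    have "intervals_in {x<..<y} x y D" using that(1) by (fastforce simp: intervals_in_def)
    from sum_lengths_le_measure[OF this] have "(\<Sum>(c, d)\<in>D. d - c) < \<delta>" using that by simp
    then show ?thesis using \<delta>(2)[OF intervals_in_mono[OF that(1)]] that by (meson less_imp_le subset_UNIV)
  qed
  have ind: "osc_sum w D \<le> real n" if "intervals_in UNIV a (min b (a + real n * (\<delta> / 2))) D" for n D
    using that
  proof (induction n arbitrary: D)
    case 0
    have "osc_sum w D = 0" unfolding osc_sum_def
    proof (rule sum.neutral, clarify)
      fix c d assume "(c, d) \<in> D"
      then have "c = d" using 0 by (fastforce simp: intervals_in_def)
      then show "norm (w d - w c) = 0" by simp
    qed
    then show ?case by simp
  next
    case (Suc n)
    let ?y = "min b (a + real n * (\<delta> / 2))" and ?z = "min b (a + real (Suc n) * (\<delta> / 2))"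
    have "real (Suc n) * (\<delta> / 2) = real n * (\<delta> / 2) + \<delta> / 2" "0 \<le> real n * (\<delta> / 2)"
      using \<delta>(1) by (auto simp: algebra_simps)
    then have o: "a \<le> ?y" "?y \<le> ?z" "?z - ?y < \<delta>" using \<open>a \<le> b\<close> \<delta>(1) by linarith+
    obtain D1 D2 where "intervals_in UNIV a ?y D1" "intervals_in UNIV ?y ?z D2"
      "osc_sum w D \<le> osc_sum w D1 + osc_sum w D2"
      by (rule intervals_in_split[OF Suc.prems o(1,2)])
    then show ?case using Suc.IH[of D1] step[of ?y ?z D2] o by linarith
  qed
  obtain n where "real n > (b - a) / (\<delta> / 2)" using reals_Archimedean2 by blast
  then have "min b (a + real n * (\<delta> / 2)) = b" using \<delta>(1) by (simp add: field_simps)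
  with ind[of n] have "osc_sum w D \<le> real n" if "intervals_in U a b D" for D U
    using intervals_in_mono[OF that, of UNIV a b] by simp
  then show thesis by (rule that)
qed

text \<open>Absolute continuity makes the supremum finite; after this, the variation is only used through its
universal property as a supremum.\<close>
lemma
  assumes ac: "abs_continuous_on_interval a b w" and "a \<le> x" "x \<le> y" "y \<le> b"
  shows osc_sum_le_variation: "intervals_in U x y D \<Longrightarrow> osc_sum w D \<le> variation w U x y"
    and variation_least: "(\<And>D. intervals_in U x y D \<Longrightarrow> osc_sum w D \<le> M) \<Longrightarrow> variation w U x y \<le> M"
    and variation_nonneg: "0 \<le> variation w U x y"
proof -
  obtain M0 where "\<And>D U. intervals_in U a b D \<Longrightarrow> osc_sum w D \<le> M0"
    using osc_sum_bounded[OF ac] assms by force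
  then have "bdd_above (osc_sum w ` {D. intervals_in U x y D})"
    using intervals_in_mono[of U x y _ U a b] assms by (fastforce intro: bdd_aboveI)
  then show *: "intervals_in U x y D \<Longrightarrow> osc_sum w D \<le> variation w U x y" for D
    unfolding variation_def by (intro cSup_upper) auto
  show "(\<And>D. intervals_in U x y D \<Longrightarrow> osc_sum w D \<le> M) \<Longrightarrow> variation w U x y \<le> M"
    unfolding variation_def by (rule cSup_least) (auto intro: intervals_in_empty)
  show "0 \<le> variation w U x y" using *[OF intervals_in_empty] by (simp add: osc_sum_def)
qed

lemma variation_split:
  assumes ac: "abs_continuous_on_interval a b w" and le: "a \<le> x" "x \<le> y" "y \<le> b"
  shows "variation w UNIV a y \<le> variation w UNIV a x + variation w UNIV x y"
proof (rule variation_least[OF ac])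
  fix D assume D: "intervals_in UNIV a y D"
  obtain D1 D2 where D12: "intervals_in UNIV a x D1" "intervals_in UNIV x y D2"
      "osc_sum w D \<le> osc_sum w D1 + osc_sum w D2"
    by (rule intervals_in_split[OF D le(1,2)])
  then show "osc_sum w D \<le> variation w UNIV a x + variation w UNIV x y"
    using osc_sum_le_variation[OF ac _ _ _ D12(1)] osc_sum_le_variation[OF ac _ _ _ D12(2)] D12(3) le by linarith
qed (use le in auto)

lemma variation_superadditive:
  assumes ac: "abs_continuous_on_interval a b w" and "a \<le> x" "x \<le> y" "y \<le> b" and U: "{x<..<y} \<subseteq> U"
  shows "variation w U a x + variation w UNIV x y \<le> variation w U a y"
proof -
  have "variation w U a x \<le> variation w U a y - variation w UNIV x y"
  proof (rule variation_least[OF ac])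
    fix D assume D: "intervals_in U a x D"
    have "variation w UNIV x y \<le> variation w U a y - osc_sum w D"
    proof (rule variation_least[OF ac])
      fix D' assume "intervals_in UNIV x y D'"
      then have D': "intervals_in U x y D'" using U by (fastforce simp: intervals_in_def)
      show "osc_sum w D' \<le> variation w U a y - osc_sum w D"
        using osc_sum_le_variation[OF ac _ _ _ intervals_in_Un[OF D D']] osc_sum_Un[OF D D', of w] assms by simp
    qed (use assms in auto)
    then show "osc_sum w D \<le> variation w U a y - variation w UNIV x y" by simp
  qed (use assms in auto)
  then show ?thesis by simp
qed

text \<open>Inside \<open>U\<close> the total variation grows no faster than the variation restricted to \<open>U\<close>, and the latter
is small as a whole when \<open>U\<close> is small. This pair of facts replaces the statement that the variation
function is itself absolutely continuous.\<close>
lemma variation_increment_le: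
  assumes ac: "abs_continuous_on_interval a b w" and "a \<le> x" "x \<le> y" "y \<le> b" and U: "{x<..<y} \<subseteq> U"
  shows "variation w UNIV a y - variation w UNIV a x \<le> variation w U a y - variation w U a x"
  using variation_split[OF assms(1-4)] variation_superadditive[OF assms] by simp

lemma norm_diff_le_variation:
  assumes ac: "abs_continuous_on_interval a b w" and "a \<le> x" "x \<le> y" "y \<le> b"
  shows "norm (w y - w x) \<le> variation w UNIV a y - variation w UNIV a x"
proof -
  have "norm (w y - w x) = osc_sum w {(x, y)}" by (simp add: osc_sum_def)
  also have "\<dots> \<le> variation w UNIV x y"
    by (rule osc_sum_le_variation[OF assms intervals_in_single]) (use assms in auto)
  finally show ?thesis using variation_superadditive[OF assms, of UNIV] by simp
qed

lemma variation_mono: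
  assumes ac: "abs_continuous_on_interval a b w" and "a \<le> x" "x \<le> y" "y \<le> b"
  shows "variation w U a x \<le> variation w U a y"
proof (rule variation_least[OF ac])
  fix D assume "intervals_in U a x D"
  then have "intervals_in U a y D" by (rule intervals_in_mono) (use assms in auto)
  then show "osc_sum w D \<le> variation w U a y"
    by (rule osc_sum_le_variation[OF ac, rotated 3]) (use assms in auto)
qed (use assms in auto)

lemma variation_small:
  assumes ac: "abs_continuous_on_interval a b w" and "0 < \<epsilon>" "a \<le> b"
  obtains \<delta> where "0 < \<delta>"
    "\<And>U. \<lbrakk>U \<in> lmeasurable; measure lebesgue U < \<delta>\<rbrakk> \<Longrightarrow> variation w U a b \<le> \<epsilon>"
    "\<And>x y. \<lbrakk>a \<le> x; x \<le> y; y \<le> b; y - x < \<delta>\<rbrakk> \<Longrightarrow> variation w UNIV a y - variation w UNIV a x \<le> \<epsilon>"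
proof -
  obtain \<delta> where \<delta>: "0 < \<delta>" "\<And>D U. \<lbrakk>intervals_in U a b D; (\<Sum>(c, d)\<in>D. d - c) < \<delta>\<rbrakk> \<Longrightarrow> osc_sum w D < \<epsilon>"
    using abs_continuous_on_intervalD[OF ac \<open>0 < \<epsilon>\<close>] by blast
  have 1: "variation w U a b \<le> \<epsilon>" if "U \<in> lmeasurable" "measure lebesgue U < \<delta>" for U
  proof (rule variation_least[OF ac])
    fix D assume D: "intervals_in U a b D"
    show "osc_sum w D \<le> \<epsilon>" using \<delta>(2)[OF D] sum_lengths_le_measure[OF D that(1)] that(2) by simp
  qed (use assms in auto)
  have 2: "variation w UNIV a y - variation w UNIV a x \<le> \<epsilon>" if "a \<le> x" "x \<le> y" "y \<le> b" "y - x < \<delta>" for x y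
  proof -
    let ?U = "{x<..<y}"
    have "variation w UNIV a y - variation w UNIV a x \<le> variation w ?U a y - variation w ?U a x"
      using variation_increment_le[OF ac] that by auto
    also have "\<dots> \<le> variation w ?U a b"
      using variation_nonneg[OF ac, of a x ?U] variation_mono[OF ac, of y b ?U] that by auto
    also have "\<dots> \<le> \<epsilon>" by (rule 1) (use that in auto)
    finally show ?thesis .
  qed
  show thesis by (rule that[OF \<delta>(1) 1 2])
qed

lemma abs_continuous_imp_continuous:
  assumes ac: "abs_continuous_on_interval a b w"
  shows "continuous_on {a..b} w"
  unfolding continuous_on_iff
proof (intro ballI allI impI)
  fix x e :: real assume x: "x \<in> {a..b}" and "0 < e"
  then obtain \<delta> where \<delta>: "0 < \<delta>" "\<And>D U. \<lbrakk>intervals_in U a b D; (\<Sum>(c, d)\<in>D. d - c) < \<delta>\<rbrakk> \<Longrightarrow> osc_sum w D < e"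
    using abs_continuous_on_intervalD[OF ac \<open>0 < e\<close>] by blast
  have *: "norm (w z - w y) < e" if "a \<le> y" "y \<le> z" "z \<le> b" "z - y < \<delta>" for y z
    using \<delta>(2)[OF intervals_in_single[of a y z b UNIV]] that by (simp add: osc_sum_def)
  have "dist (w y) (w x) < e" if "y \<in> {a..b}" "dist y x < \<delta>" for y
    using *[of x y] *[of y x] that x by (cases "x \<le> y") (auto simp: dist_norm norm_minus_commute abs_if split: if_splits)
  then show "\<exists>d>0. \<forall>x'\<in>{a..b}. dist x' x < d \<longrightarrow> dist (w x') (w x) < e" using \<delta>(1) by blast
qed

section \<open>The fundamental theorem of calculus for absolutely continuous functions\<close>

text \<open>A continuous induction from left to right. At a point outside \<open>U\<close> a step that does not decrease \<open>w\<close>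
is available by assumption; inside \<open>U\<close> the decrease of \<open>w\<close> is charged to \<open>\<omega>\<close>, whose total increase
is the only loss. With \<open>U\<close> an open neighbourhood of a null set, this says that an
absolutely continuous function with positive upper right derivative almost everywhere is
nondecreasing.\<close>
lemma increasing_up_to_small_open_set:
  fixes w \<omega> :: "real \<Rightarrow> real"
  assumes "a \<le> b" and w: "continuous_on {a..b} w"
    and \<omega>: "mono_on {a..b} \<omega>" and U: "open U"
    and inU: "\<And>x y. \<lbrakk>a \<le> x; x \<le> y; y \<le> b; {x<..<y} \<subseteq> U\<rbrakk> \<Longrightarrow> w x - w y \<le> \<omega> y - \<omega> x"
    and good: "\<And>x. \<lbrakk>a \<le> x; x < b; x \<notin> U\<rbrakk> \<Longrightarrow> \<exists>y. x < y \<and> y \<le> b \<and> w x \<le> w y"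
  shows "w a - w b \<le> \<omega> b - \<omega> a"
proof -
  define T where "T = {x\<in>{a..b}. w a - w x \<le> \<omega> x - \<omega> a}"
  define z where "z = Sup T"
  have mono: "\<omega> x \<le> \<omega> y" if "a \<le> x" "x \<le> y" "y \<le> b" for x y
    using mono_onD[OF \<omega>, of x y] that by auto
  have aT: "a \<in> T" using \<open>a \<le> b\<close> by (auto simp: T_def)
  have bdd: "bdd_above T" by (rule bdd_aboveI[of _ b]) (auto simp: T_def)
  have Tle: "x \<le> z" if "x \<in> T" for x using cSup_upper[OF that bdd] by (simp add: z_def)
  have "z \<le> b" unfolding z_def by (rule cSup_least) (use aT in \<open>auto simp: T_def\<close>)
  then have z: "z \<in> {a..b}" using Tle[OF aT] by simp
  obtain X where X: "\<And>n. X n \<in> T" "X \<longlonglongrightarrow> z"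
    using closure_contains_Sup[OF _ bdd] aT unfolding z_def closure_sequential by blast
  have lim: "(\<lambda>n. w (X n)) \<longlonglongrightarrow> w z"
    by (rule continuous_on_tendsto_compose[OF w X(2) z]) (use X(1) in \<open>auto simp: T_def\<close>)
  have "w a - (\<omega> z - \<omega> a) \<le> w (X n)" for n
    using X(1)[of n] mono[of "X n" z] Tle[OF X(1)[of n]] z by (auto simp: T_def)
  then have "w a - (\<omega> z - \<omega> a) \<le> w z" using LIMSEQ_le_const[OF lim] by blast
  then have wz: "w a - w z \<le> \<omega> z - \<omega> a" by simp
  have "z = b"
  proof (rule ccontr)
    assume "z \<noteq> b"
    then have "z < b" using z by simp
    have "\<exists>y>z. y \<le> b \<and> w z - w y \<le> \<omega> y - \<omega> z"
    proof (cases "z \<in> U")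
      case True
      then obtain e where e: "e > 0" "ball z e \<subseteq> U" using U open_contains_ball by blast
      define y where "y = min b (z + e)"
      have "{z<..<y} \<subseteq> ball z e" by (auto simp: y_def dist_real_def)
      then have "w z - w y \<le> \<omega> y - \<omega> z" by (intro inU) (use e z in \<open>auto simp: y_def\<close>)
      moreover have "z < y" "y \<le> b" using \<open>z < b\<close> e by (auto simp: y_def)
      ultimately show ?thesis by blast
    next
      case False
      then obtain y where "z < y" "y \<le> b" "w z \<le> w y" using good[of z] z \<open>z < b\<close> by auto
      then show ?thesis using mono[of z y] z by (intro exI[of _ y]) auto
    qed
    then obtain y where "y > z" "y \<le> b" "w z - w y \<le> \<omega> y - \<omega> z" by blast
    then have "y \<in> T" using wz z by (auto simp: T_def)
    then show False using Tle \<open>y > z\<close> by force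
  qed
  then show ?thesis using wz by simp
qed

text \<open>Shifting the variable, the integral of the difference quotient is the difference of the mean values
of \<open>G\<close> over \<open>[b, b + h]\<close> and \<open>[a, a + h]\<close>, the first of which is \<open>G b\<close>.\<close>
lemma integral_mono_shift_le:
  fixes G :: "real \<Rightarrow> real"
  assumes G: "mono G" and "a \<le> b" "0 < h" and b: "G (b + h) = G b"
  shows "integral {a..b} (\<lambda>x. (G (x + h) - G x) / h) \<le> G b - G a"
    and "(\<lambda>x. (G (x + h) - G x) / h) integrable_on {a..b}"
proof -
  have io: "G integrable_on {x..y}" for x y
    by (rule integrable_on_mono_on) (use G in \<open>auto simp: mono_on_def mono_def\<close>)
  have ih: "(\<lambda>x. G (x + h)) integrable_on {a..b}"
    by (rule integrable_on_mono_on) (use G in \<open>auto simp: mono_on_def mono_def\<close>)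
  show "(\<lambda>x. (G (x + h) - G x) / h) integrable_on {a..b}"
    using integrable_diff[OF ih io] by (rule integrable_on_divide)
  have "integral {a..b} (\<lambda>x. G (x + h)) = integral {a + h..b + h} G"
    using integral_shift_real_ivl[of "a + h" h "b + h" G] by simp
  moreover have "integral {a..a + h} G + integral {a + h..b + h} G = integral {a..b} G + integral {b..b + h} G"
    using Henstock_Kurzweil_Integration.integral_combine[OF _ _ io, of a "a + h" "b + h"]
      Henstock_Kurzweil_Integration.integral_combine[OF _ _ io, of a b "b + h"] assms by simp
  moreover have "integral {b..b + h} G \<le> integral {b..b + h} (\<lambda>_. G b)"
    by (rule integral_le[OF io]) (use monoD[OF G, of _ "b + h"] b in auto)
  moreover have "integral {a..a + h} (\<lambda>_. G a) \<le> integral {a..a + h} G"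
    by (rule integral_le[OF _ io]) (use G in \<open>auto simp: mono_def\<close>)
  ultimately have "integral {a..b} (\<lambda>x. G (x + h)) - integral {a..b} G \<le> h * (G b - G a)"
    using \<open>0 < h\<close> by (simp add: algebra_simps)
  moreover have "integral {a..b} (\<lambda>x. (G (x + h) - G x) / h) = (integral {a..b} (\<lambda>x. G (x + h)) - integral {a..b} G) / h"
    using Henstock_Kurzweil_Integration.integral_diff[OF ih io] by simp
  ultimately show "integral {a..b} (\<lambda>x. (G (x + h) - G x) / h) \<le> G b - G a"
    using \<open>0 < h\<close> by (simp add: field_simps)
qed

text \<open>Fatou's lemma for the difference quotients with steps \<open>1 / (n + 1)\<close>. Only a property of the lower
limit \<open>f\<close> that is easy to use is exported: almost everywhere, difference quotients with
arbitrarily short steps are less than \<open>f + e\<close>. That \<open>G\<close> is constant to the right of \<open>b\<close> makes the quotients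
meaningful up to the end point.\<close>
lemma mono_liminf_quotient_integrable:
  fixes G :: "real \<Rightarrow> real"
  assumes G: "mono G" and "a \<le> b" and b: "\<And>x. b \<le> x \<Longrightarrow> G x = G b"
  obtains f N where "f \<in> borel_measurable borel" "integrable lborel f" "\<And>x. 0 \<le> f x"
    "integral {a..b} f \<le> G b - G a" "negligible N"
    "\<And>x e n0. \<lbrakk>x \<in> {a..b} - N; 0 < e\<rbrakk> \<Longrightarrow> \<exists>n\<ge>n0. (G (x + inverse (Suc n)) - G x) / inverse (Suc n) < f x + e"
proof -
  define q where "q n x = (G (x + inverse (Suc n)) - G x) / inverse (Suc n)" for n x
  have [measurable]: "G \<in> borel_measurable borel" using G by (rule borel_measurable_mono)
  have [measurable]: "q n \<in> borel_measurable borel" for n unfolding q_def by measurable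
  have q0: "0 \<le> q n x" for n x using G by (auto simp: q_def mono_def)
  define F where "F x = liminf (\<lambda>n. ennreal (q n x) * indicator {a..b} x)" for x
  have [measurable]: "F \<in> borel_measurable borel" unfolding F_def by measurable
  have "(\<integral>\<^sup>+x. ennreal (q n x) * indicator {a..b} x \<partial>lborel) \<le> ennreal (G b - G a)" for n
  proof -
    have i: "integral {a..b} (q n) \<le> G b - G a" "q n integrable_on {a..b}"
    proof -
      have qe: "q n = (\<lambda>x. (G (x + inverse (Suc n)) - G x) / inverse (Suc n))" by (auto simp: q_def)
      have h: "0 < inverse (real (Suc n))" by simp
      have bb: "G (b + inverse (real (Suc n))) = G b" by (rule b) simp
      show "integral {a..b} (q n) \<le> G b - G a" "q n integrable_on {a..b}"
        unfolding qe by (rule integral_mono_shift_le[OF G \<open>a \<le> b\<close> h bb])+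
    qed
    have "((\<lambda>x. if x \<in> {a..b} then q n x else 0) has_integral integral {a..b} (q n)) UNIV"
      using i(2) unfolding has_integral_restrict_UNIV by (rule integrable_integral)
    then have "(\<integral>\<^sup>+x. ennreal (if x \<in> {a..b} then q n x else 0) \<partial>lborel) = ennreal (integral {a..b} (q n))"
      by (rule nn_integral_has_integral_lborel[rotated 2]) (use q0 in auto)
    also have "(\<lambda>x. ennreal (if x \<in> {a..b} then q n x else 0)) = (\<lambda>x. ennreal (q n x) * indicator {a..b} x)"
      by (auto simp: indicator_def)
    finally show ?thesis using i(1) by (simp add: ennreal_leI)
  qed
  then have "liminf (\<lambda>n. \<integral>\<^sup>+x. ennreal (q n x) * indicator {a..b} x \<partial>lborel) \<le> ennreal (G b - G a)"
    by (intro Liminf_le always_eventually allI) simp_all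
  then have Fint: "(\<integral>\<^sup>+x. F x \<partial>lborel) \<le> ennreal (G b - G a)"
    unfolding F_def by (rule order_trans[OF nn_integral_liminf, rotated]) measurable
  define f where "f x = enn2real (F x)" for x
  have [measurable]: "f \<in> borel_measurable borel" unfolding f_def by measurable
  have "AE x in lborel. F x \<noteq> \<infinity>"
    by (rule nn_integral_PInf_AE) (use Fint in \<open>auto simp: top_unique\<close>)
  then have fF: "AE x in lborel. ennreal (f x) = F x"
    by eventually_elim (simp add: f_def less_top)
  then have fnn: "(\<integral>\<^sup>+x. ennreal (f x) \<partial>lborel) = (\<integral>\<^sup>+x. F x \<partial>lborel)"
    by (rule nn_integral_cong_AE)
  have fi: "integrable lborel f"
    by (rule integrableI_nonneg) (use fnn Fint in \<open>auto simp: f_def less_top[symmetric] top_unique\<close>)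
  have supp: "f x = 0" if "x \<notin> {a..b}" for x using that by (simp add: f_def F_def Liminf_const)
  have "(\<lambda>x. if x \<in> {a..b} then f x else 0) = f" using supp by (intro ext) metis
  then have "integral {a..b} f = integral UNIV f"
    using integral_restrict_UNIV[of "{a..b}" f] by simp
  also have "\<dots> = (\<integral>x. f x \<partial>lborel)" by (rule integral_lborel[OF fi])
  also have "\<dots> \<le> G b - G a"
  proof -
    have "ennreal (\<integral>x. f x \<partial>lborel) = (\<integral>\<^sup>+x. ennreal (f x) \<partial>lborel)"
      by (rule nn_integral_eq_integral[symmetric, OF fi]) (simp add: f_def)
    then have "ennreal (\<integral>x. f x \<partial>lborel) \<le> ennreal (G b - G a)" using fnn Fint by simp
    then show ?thesis using G \<open>a \<le> b\<close> by (subst (asm) ennreal_le_iff) (auto simp: mono_def)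
  qed
  finally have int_le: "integral {a..b} f \<le> G b - G a" .
  obtain N where N: "N \<in> null_sets lborel" "{x. ennreal (f x) \<noteq> F x} \<subseteq> N"
    using fF unfolding eventually_ae_filter by auto
  have neg: "negligible N" using N(1) null_sets_completionI by (auto simp: negligible_iff_null_sets)
  have freq: "\<exists>n\<ge>n0. (G (x + inverse (Suc n)) - G x) / inverse (Suc n) < f x + e" if x: "x \<in> {a..b} - N" and "0 < e" for x e n0
  proof (rule ccontr)
    assume "\<not> ?thesis"
    then have "f x + e \<le> q n x" if "n \<ge> n0" for n using that unfolding q_def by (auto simp: not_less)
    then have "\<forall>\<^sub>F n in sequentially. ennreal (f x + e) \<le> ennreal (q n x) * indicator {a..b} x"
      using x by (intro eventually_sequentiallyI[of n0]) (auto intro: ennreal_leI)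
    then have "ennreal (f x + e) \<le> F x" unfolding F_def by (rule Liminf_bounded)
    also have "F x = ennreal (f x)" using N(2) x by (blast intro: sym)
    finally show False using \<open>0 < e\<close> by (subst (asm) ennreal_le_iff) (auto simp: f_def)
  qed
  show thesis by (rule that[OF _ fi _ int_le neg freq]) (auto simp: f_def)
qed

lemma negligible_outer_open:
  fixes S :: "real set"
  assumes S: "negligible S" and "0 < e"
  obtains U where "open U" "S \<subseteq> U" "U \<in> lmeasurable" "measure lebesgue U < e"
proof -
  obtain U where U: "open U" "S \<subseteq> U" "U - S \<in> lmeasurable" "emeasure lebesgue (U - S) < ennreal e"
    using sets_lebesgue_outer_open[of S e] S \<open>0 < e\<close> negligible_imp_sets by blast
  have "S \<in> lmeasurable" using S by (rule negligible_imp_measurable)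
  then have Um: "U \<in> lmeasurable" using fmeasurable.Un[OF U(3)] U(2) by (metis Diff_partition sup_commute)
  have "measure lebesgue U = measure lebesgue (U - S)"
    by (rule measure_negligible_symdiff[OF U(3)]) (rule negligible_subset[OF S], auto)
  also have "\<dots> < e" using U(3,4) \<open>0 < e\<close> by (simp add: emeasure_eq_measure2 ennreal_less_iff)
  finally show thesis using that U Um by blast
qed

text \<open>Let \<open>F\<close> be the indefinite integral of the lower derivative \<open>f\<close> of \<open>G\<close>. At almost every point the
difference quotients of \<open>F\<close> tend to \<open>f\<close>, while those of \<open>G\<close> fall below \<open>f + e\<close> for arbitrarily
short steps; so \<open>F - G\<close> is nondecreasing by the continuous induction. By Fatou its total increment is at
most zero, and it is constant. The hypothesis on \<open>\<omega>\<close> is the form in which the absolute continuity of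
\<open>G\<close> enters: it excludes growth of \<open>G\<close> concentrated on a null set.\<close>
lemma mono_eq_integral:
  fixes G :: "real \<Rightarrow> real"
  assumes G: "mono G" and "a \<le> b" and b: "\<And>x. b \<le> x \<Longrightarrow> G x = G b" and cont: "continuous_on {a..b} G"
    and small: "\<And>\<epsilon>. 0 < \<epsilon> \<Longrightarrow> \<exists>\<delta>>0. \<forall>U. open U \<and> U \<in> lmeasurable \<and> measure lebesgue U < \<delta> \<longrightarrow>
      (\<exists>\<omega>. mono_on {a..b} \<omega> \<and> \<omega> b - \<omega> a \<le> \<epsilon> \<and>
        (\<forall>x y. a \<le> x \<and> x \<le> y \<and> y \<le> b \<and> {x<..<y} \<subseteq> U \<longrightarrow> G y - G x \<le> \<omega> y - \<omega> x))"
  obtains f where "f \<in> borel_measurable borel" "integrable lborel f"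
    "\<And>x. x \<in> {a..b} \<Longrightarrow> G x = G a + integral {a..x} f"
proof -
  obtain f N where f: "f \<in> borel_measurable borel" "integrable lborel f" "\<And>x. 0 \<le> f x"
    and le: "integral {a..b} f \<le> G b - G a" and N: "negligible N"
    and freq: "\<And>x e n0. \<lbrakk>x \<in> {a..b} - N; 0 < e\<rbrakk> \<Longrightarrow> \<exists>n\<ge>n0. (G (x + inverse (Suc n)) - G x) / inverse (Suc n) < f x + e"
    by (rule mono_liminf_quotient_integrable[OF G \<open>a \<le> b\<close> b]) (assumption, rule that, assumption+)
  have io: "f integrable_on {x..y}" for x y
    using integrable_on_subinterval[OF integrable_on_lborel[OF f(2)]] by simp
  obtain N' where N': "negligible N'" and ldt: "\<And>x e. \<lbrakk>x \<notin> N'; 0 < e\<rbrakk> \<Longrightarrow>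
      \<exists>d>0. \<forall>h. 0 < h \<and> h < d \<longrightarrow> norm (integral {x..x + h} f /\<^sub>R h - f x) < e"
    using integrable_ccontinuous_explicit[of f] io by (auto simp: cbox_interval)
  define F where "F x = integral {a..x} f" for x
  have Fdiff: "F y - F x = integral {x..y} f" if "a \<le> x" "x \<le> y" for x y
    using Henstock_Kurzweil_Integration.integral_combine[OF that io] by (simp add: F_def)
  have Fmono: "F x \<le> F y" if "a \<le> x" "x \<le> y" for x y
    using Fdiff[OF that] integral_nonneg[OF io, of x y] f(3) by simp
  have Fcont: "continuous_on {a..b} F"
    unfolding F_def by (rule indefinite_integral_continuous_1[OF io])
  have key: "G d - G c \<le> F d - F c" if cd: "a \<le> c" "c \<le> d" "d \<le> b" for c d
  proof -
    have approx: "G d - G c - (F d - F c) \<le> \<epsilon> + 2 * \<eta> * (d - c)" if "0 < \<epsilon>" "0 < \<eta>" for \<epsilon> \<eta>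
    proof -
      obtain \<delta> where \<delta>: "0 < \<delta>" and sm: "\<And>U. \<lbrakk>open U; U \<in> lmeasurable; measure lebesgue U < \<delta>\<rbrakk> \<Longrightarrow>
        \<exists>\<omega>. mono_on {a..b} \<omega> \<and> \<omega> b - \<omega> a \<le> \<epsilon> \<and>
        (\<forall>x y. a \<le> x \<and> x \<le> y \<and> y \<le> b \<and> {x<..<y} \<subseteq> U \<longrightarrow> G y - G x \<le> \<omega> y - \<omega> x)"
        using small[OF \<open>0 < \<epsilon>\<close>] by auto
      have NN: "negligible (N \<union> N')" using N N' by (rule negligible_Un)
      obtain U where U: "open U" "N \<union> N' \<subseteq> U" "U \<in> lmeasurable" "measure lebesgue U < \<delta>"
        by (rule negligible_outer_open[OF NN \<delta>])
      obtain \<omega> where \<omega>: "mono_on {a..b} \<omega>" "\<omega> b - \<omega> a \<le> \<epsilon>"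
        "\<And>x y. \<lbrakk>a \<le> x; x \<le> y; y \<le> b; {x<..<y} \<subseteq> U\<rbrakk> \<Longrightarrow> G y - G x \<le> \<omega> y - \<omega> x"
        using sm[OF U(1,3,4)] by auto
      \<comment> \<open>the linear term absorbs an error \<open>\<eta>\<close> in each of the difference quotients of \<open>F\<close> and \<open>G\<close>\<close>
      define w where "w x = F x - G x + 2 * \<eta> * x" for x
      have "w c - w d \<le> \<omega> d - \<omega> c"
      proof (rule increasing_up_to_small_open_set[OF cd(2) _ _ U(1)])
        show "continuous_on {c..d} w"
          unfolding w_def by (intro continuous_intros continuous_on_subset[OF Fcont] continuous_on_subset[OF cont]) (use cd in auto)
        show "mono_on {c..d} \<omega>" by (rule mono_on_subset[OF \<omega>(1)]) (use cd in auto)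
        show "w x - w y \<le> \<omega> y - \<omega> x" if "c \<le> x" "x \<le> y" "y \<le> d" "{x<..<y} \<subseteq> U" for x y
        proof -
          have "G y - G x \<le> \<omega> y - \<omega> x" "F x \<le> F y" "2 * \<eta> * x \<le> 2 * \<eta> * y"
            using \<omega>(3)[of x y] Fmono[of x y] that cd \<open>0 < \<eta>\<close> by auto
          then show ?thesis by (simp add: w_def)
        qed
        show "\<exists>y. x < y \<and> y \<le> d \<and> w x \<le> w y" if x: "c \<le> x" "x < d" "x \<notin> U" for x
        proof -
          have xN: "x \<in> {a..b} - N" "x \<notin> N'" using x U(2) cd by auto
          obtain r where r: "r > 0" "\<And>h. \<lbrakk>0 < h; h < r\<rbrakk> \<Longrightarrow> norm (integral {x..x + h} f /\<^sub>R h - f x) < \<eta>"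
            using ldt[OF xN(2) \<open>0 < \<eta>\<close>] by auto
          obtain n0 where n0: "inverse (real (Suc n0)) < min r (d - x)"
            using reals_Archimedean[of "min r (d - x)"] r(1) x by auto
          obtain n where n: "n \<ge> n0" "(G (x + inverse (Suc n)) - G x) / inverse (Suc n) < f x + \<eta>"
            using freq[OF xN(1) \<open>0 < \<eta>\<close>] by blast
          define h where "h = inverse (real (Suc n))"
          have "h \<le> inverse (real (Suc n0))" unfolding h_def by (rule le_imp_inverse_le) (use n in auto)
          then have h: "0 < h" "h < r" "x + h \<le> d" using n0 by (simp add: h_def, linarith, linarith)
          have "\<bar>integral {x..x + h} f / h - f x\<bar> < \<eta>"
            using r(2)[OF h(1,2)] by (simp add: divide_inverse mult.commute)
          then have "f x - \<eta> < integral {x..x + h} f / h" by linarith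
          then have "(f x - \<eta>) * h < integral {x..x + h} f" using h(1) by (simp add: pos_less_divide_eq)
          moreover have "G (x + h) - G x < (f x + \<eta>) * h"
            using n(2) h(1) unfolding h_def[symmetric] by (simp add: pos_divide_less_eq)
          moreover have "F (x + h) - F x = integral {x..x + h} f" by (rule Fdiff) (use x cd h in auto)
          ultimately have "w x \<le> w (x + h)" by (simp add: w_def algebra_simps)
          then show ?thesis using h by (intro exI[of _ "x + h"]) auto
        qed
      qed
      moreover have "\<omega> d - \<omega> c \<le> \<omega> b - \<omega> a"
        using mono_onD[OF \<omega>(1), of a c] mono_onD[OF \<omega>(1), of d b] cd \<open>a \<le> b\<close> by auto
      ultimately show ?thesis using \<omega>(2) by (simp add: w_def algebra_simps)
    qed
    have "G d - G c - (F d - F c) \<le> 0"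
    proof (rule field_le_epsilon)
      fix e :: real assume "0 < e"
      define \<eta> where "\<eta> = e / 2 / (2 * (d - c) + 1)"
      have "\<eta> > 0" using \<open>0 < e\<close> cd by (simp add: \<eta>_def)
      moreover have "2 * \<eta> * (d - c) \<le> e / 2"
        using \<open>0 < e\<close> cd by (simp add: \<eta>_def field_simps)
      ultimately show "G d - G c - (F d - F c) \<le> 0 + e" using approx[of "e / 2" \<eta>] \<open>0 < e\<close> by linarith
    qed
    then show ?thesis by simp
  qed
  have Fa: "F a = 0" by (simp add: F_def)
  have "G x = G a + integral {a..x} f" if "x \<in> {a..b}" for x
    using key[of a x] key[of x b] that Fa le by (simp add: F_def)
  with f(1,2) show thesis by (rule that)
qed

text \<open>Both the variation \<open>V\<close> and \<open>V - w\<close> are nondecreasing with increments at most twice those of \<open>V\<close>, and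
\<open>w\<close> is their difference.\<close>
lemma abs_continuous_real_eq_integral:
  fixes w :: "real \<Rightarrow> real"
  assumes ac: "abs_continuous_on_interval a b w" and "a \<le> b"
  obtains f where "f \<in> borel_measurable borel" "integrable lborel f"
    "\<And>x. x \<in> {a..b} \<Longrightarrow> w x = w a + integral {a..x} f"
proof -
  define p where "p x = max a (min b x)" for x
  have p: "p x \<in> {a..b}" for x using \<open>a \<le> b\<close> by (auto simp: p_def)
  have pid: "p x = x" if "x \<in> {a..b}" for x using that by (auto simp: p_def)
  have pmono: "p x \<le> p y" if "x \<le> y" for x y using that by (auto simp: p_def)
  have pb: "p x = b" if "b \<le> x" for x using that \<open>a \<le> b\<close> by (auto simp: p_def)
  let ?V = "variation w UNIV a"
  have main: "\<exists>f. f \<in> borel_measurable borel \<and> integrable lborel f \<and> (\<forall>x\<in>{a..b}. H x = H a + integral {a..x} f)"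
    if H: "\<And>x y. \<lbrakk>a \<le> x; x \<le> y; y \<le> b\<rbrakk> \<Longrightarrow> 0 \<le> H y - H x \<and> H y - H x \<le> 2 * (?V y - ?V x)" for H :: "real \<Rightarrow> real"
  proof -
    \<comment> \<open>clamping makes \<open>H\<close> monotone on the whole line and constant to the right of \<open>b\<close>\<close>
    define G where "G x = H (p x)" for x
    have G: "G x = H x" if "x \<in> {a..b}" for x using pid[OF that] by (simp add: G_def)
    have mono: "mono G"
    proof (rule monoI)
      fix x y :: real assume "x \<le> y"
      then show "G x \<le> G y" using H[of "p x" "p y"] pmono[of x y] p[of x] p[of y] by (simp add: G_def)
    qed
    have cont: "continuous_on {a..b} G"
      unfolding continuous_on_iff
    proof (intro ballI allI impI)
      fix x e :: real assume x: "x \<in> {a..b}" and "0 < e"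
      obtain \<delta> where \<delta>: "0 < \<delta>" "\<And>x y. \<lbrakk>a \<le> x; x \<le> y; y \<le> b; y - x < \<delta>\<rbrakk> \<Longrightarrow> ?V y - ?V x \<le> e / 4"
        by (rule variation_small[OF ac _ \<open>a \<le> b\<close>, of "e / 4"]) (use \<open>0 < e\<close> in simp, rule that, assumption+)
      have "dist (G y) (G x) < e" if "y \<in> {a..b}" "dist y x < \<delta>" for y
        using H[of x y] H[of y x] \<delta>(2)[of x y] \<delta>(2)[of y x] that x G \<open>0 < e\<close>
        by (cases "x \<le> y") (auto simp: dist_real_def abs_if split: if_splits)
      then show "\<exists>d>0. \<forall>x'\<in>{a..b}. dist x' x < d \<longrightarrow> dist (G x') (G x) < e" using \<delta>(1) by blast
    qed
    have small: "\<exists>\<delta>>0. \<forall>U. open U \<and> U \<in> lmeasurable \<and> measure lebesgue U < \<delta> \<longrightarrow>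
      (\<exists>\<omega>. mono_on {a..b} \<omega> \<and> \<omega> b - \<omega> a \<le> \<epsilon> \<and>
        (\<forall>x y. a \<le> x \<and> x \<le> y \<and> y \<le> b \<and> {x<..<y} \<subseteq> U \<longrightarrow> G y - G x \<le> \<omega> y - \<omega> x))" if "0 < \<epsilon>" for \<epsilon>
    proof -
      obtain \<delta> where \<delta>: "0 < \<delta>" "\<And>U. \<lbrakk>U \<in> lmeasurable; measure lebesgue U < \<delta>\<rbrakk> \<Longrightarrow> variation w U a b \<le> \<epsilon> / 2"
        by (rule variation_small[OF ac _ \<open>a \<le> b\<close>, of "\<epsilon> / 2"]) (use \<open>0 < \<epsilon>\<close> in simp, rule that, assumption+)
      have "\<exists>\<omega>. mono_on {a..b} \<omega> \<and> \<omega> b - \<omega> a \<le> \<epsilon> \<and>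
        (\<forall>x y. a \<le> x \<and> x \<le> y \<and> y \<le> b \<and> {x<..<y} \<subseteq> U \<longrightarrow> G y - G x \<le> \<omega> y - \<omega> x)"
        if U: "U \<in> lmeasurable" "measure lebesgue U < \<delta>" for U
      proof (intro exI conjI allI impI)
        \<comment> \<open>the factor \<open>2\<close> is the one in the assumption on the increments of \<open>H\<close>\<close>
        let ?\<omega> = "\<lambda>x. 2 * variation w U a x"
        show "mono_on {a..b} ?\<omega>"
          by (rule mono_onI) (use variation_mono[OF ac] in auto)
        show "?\<omega> b - ?\<omega> a \<le> \<epsilon>"
          using \<delta>(2)[OF U] variation_nonneg[OF ac, of a a U] \<open>a \<le> b\<close> by simp
        fix x y assume xy: "a \<le> x \<and> x \<le> y \<and> y \<le> b \<and> {x<..<y} \<subseteq> U"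
        then show "G y - G x \<le> ?\<omega> y - ?\<omega> x"
          using H[of x y] variation_increment_le[OF ac, of x y U] G[of x] G[of y] by auto
      qed
      then show ?thesis using \<delta>(1) by blast
    qed
    have "G x = G b" if "b \<le> x" for x using pb[OF that] pb[of b] by (simp add: G_def)
    from mono_eq_integral[OF mono \<open>a \<le> b\<close> this cont small]
    obtain f where f: "f \<in> borel_measurable borel" "integrable lborel f" "\<And>x. x \<in> {a..b} \<Longrightarrow> G x = G a + integral {a..x} f"
      by blast
    have "H x = H a + integral {a..x} f" if "x \<in> {a..b}" for x
      using f(3)[OF that] G[OF that] G[of a] \<open>a \<le> b\<close> by simp
    with f(1,2) show ?thesis by blast
  qed
  have dV: "\<bar>w y - w x\<bar> \<le> ?V y - ?V x" if "a \<le> x" "x \<le> y" "y \<le> b" for x y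
    using norm_diff_le_variation[OF ac that] by simp
  have "0 \<le> ?V y - ?V x \<and> ?V y - ?V x \<le> 2 * (?V y - ?V x)" if "a \<le> x" "x \<le> y" "y \<le> b" for x y
    using dV[OF that] abs_ge_zero[of "w y - w x"] by auto
  from main[of ?V, OF this] obtain f where f: "f \<in> borel_measurable borel" "integrable lborel f"
    "\<And>x. x \<in> {a..b} \<Longrightarrow> ?V x = ?V a + integral {a..x} f" by blast
  have "0 \<le> (?V y - w y) - (?V x - w x) \<and> (?V y - w y) - (?V x - w x) \<le> 2 * (?V y - ?V x)"
    if "a \<le> x" "x \<le> y" "y \<le> b" for x y
    using dV[OF that] by (auto simp: abs_le_iff)
  from main[of "\<lambda>x. ?V x - w x", OF this] obtain g where g: "g \<in> borel_measurable borel" "integrable lborel g"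
    "\<And>x. x \<in> {a..b} \<Longrightarrow> ?V x - w x = ?V a - w a + integral {a..x} g" by blast
  have io: "f integrable_on {a..x}" "g integrable_on {a..x}" for x
    using integrable_on_subinterval[OF integrable_on_lborel[OF f(2)]] integrable_on_subinterval[OF integrable_on_lborel[OF g(2)]] by simp_all
  have "w x = w a + integral {a..x} (\<lambda>y. f y - g y)" if "x \<in> {a..b}" for x
    using f(3)[OF that] g(3)[OF that] Henstock_Kurzweil_Integration.integral_diff[OF io] by simp
  then show thesis by (rule that[rotated 2]) (use f(1,2) g(1,2) in auto)
qed

text \<open>The differentiation theorem for intervals to the right of a point is applied to \<open>f\<close> and to its
reflection \<open>\<lambda>x. f (- x)\<close>, which gives both one-sided derivatives.\<close>
lemma indefinite_integral_has_vector_derivative_ae: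
  fixes f :: "real \<Rightarrow> 'a::euclidean_space"
  assumes io: "\<And>x y. f integrable_on {x..y}"
  obtains N where "negligible N"
    "\<And>a x. \<lbrakk>a < x; x \<notin> N\<rbrakk> \<Longrightarrow> ((\<lambda>y. integral {a..y} f) has_vector_derivative f x) (at x)"
proof -
  obtain N where N: "negligible N" and r: "\<And>x e. \<lbrakk>x \<notin> N; 0 < e\<rbrakk> \<Longrightarrow>
      \<exists>d>0. \<forall>h. 0 < h \<and> h < d \<longrightarrow> norm (integral {x..x + h} f /\<^sub>R h - f x) < e"
    using integrable_ccontinuous_explicit[of f] io by (auto simp: cbox_interval)
  have io': "(\<lambda>x. f (- x)) integrable_on {x..y}" for x y
    using io[of "- y" "- x"] Henstock_Kurzweil_Integration.integrable_reflect_real[where f = f and a = "- y" and b = "- x"] by simp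
  obtain N' where N': "negligible N'" and l: "\<And>x e. \<lbrakk>x \<notin> N'; 0 < e\<rbrakk> \<Longrightarrow>
      \<exists>d>0. \<forall>h. 0 < h \<and> h < d \<longrightarrow> norm (integral {x..x + h} (\<lambda>x. f (- x)) /\<^sub>R h - f (- x)) < e"
    using integrable_ccontinuous_explicit[of "\<lambda>x. f (- x)"] io' by (auto simp: cbox_interval)
  have scale: "norm (I - h *\<^sub>R c) \<le> e * h" if "0 < h" "norm (I /\<^sub>R h - c) < e" for I c :: 'a and h e :: real
  proof -
    have "I - h *\<^sub>R c = h *\<^sub>R (I /\<^sub>R h - c)" using that by (simp add: scaleR_diff_right)
    then have "norm (I - h *\<^sub>R c) = h * norm (I /\<^sub>R h - c)" using that by simp
    also have "\<dots> \<le> h * e" using that by (intro mult_left_mono) auto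
    finally show ?thesis by (simp add: mult.commute)
  qed
  have "negligible (N \<union> uminus ` N')"
    using N N' by (intro negligible_Un) (auto intro!: negligible_differentiable_image_negligible derivative_intros)
  moreover have "((\<lambda>y. integral {a..y} f) has_vector_derivative f x) (at x)"
    if "a < x" and x: "x \<notin> N \<union> uminus ` N'" for a x
    unfolding has_vector_derivative_def has_derivative_at_alt
  proof (intro conjI allI impI)
    show "bounded_linear (\<lambda>h. h *\<^sub>R f x)" by (rule bounded_linear_scaleR_left)
    fix e :: real assume "0 < e"
    have x': "x \<notin> N" "- x \<notin> N'" using x by (auto simp: image_iff)
    obtain d where d: "d > 0" "\<And>h. \<lbrakk>0 < h; h < d\<rbrakk> \<Longrightarrow> norm (integral {x..x + h} f /\<^sub>R h - f x) < e"
      using r[OF x'(1) \<open>0 < e\<close>] by auto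
    obtain d' where d': "d' > 0" "\<And>h. \<lbrakk>0 < h; h < d'\<rbrakk> \<Longrightarrow> norm (integral {-x..-x + h} (\<lambda>x. f (- x)) /\<^sub>R h - f x) < e"
      using l[OF x'(2) \<open>0 < e\<close>] by auto
    show "\<exists>d>0. \<forall>y. norm (y - x) < d \<longrightarrow>
       norm (integral {a..y} f - integral {a..x} f - (y - x) *\<^sub>R f x) \<le> e * norm (y - x)"
    proof (intro exI[of _ "min (min d d') (x - a)"] conjI allI impI)
      fix y assume y: "norm (y - x) < min (min d d') (x - a)"
      consider "x < y" | "y = x" | "y < x" by linarith
      then show "norm (integral {a..y} f - integral {a..x} f - (y - x) *\<^sub>R f x) \<le> e * norm (y - x)"
      proof cases
        case 1
        have "integral {a..y} f - integral {a..x} f = integral {x..y} f"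
          using Henstock_Kurzweil_Integration.integral_combine[OF _ _ io, of a x y] 1 \<open>a < x\<close> by (simp add: algebra_simps)
        then show ?thesis using scale[OF _ d(2)[of "y - x"]] 1 y by simp
      next
        case 3
        have "integral {a..x} f - integral {a..y} f = integral {y..x} f"
          using Henstock_Kurzweil_Integration.integral_combine[OF _ _ io, of a y x] 3 y by (simp add: algebra_simps)
        also have "\<dots> = integral {- x..- x + (x - y)} (\<lambda>x. f (- x))"
          using Henstock_Kurzweil_Integration.integral_reflect_real[of x y f] by simp
        finally have "norm (integral {a..x} f - integral {a..y} f - (x - y) *\<^sub>R f x) \<le> e * (x - y)"
          using scale[OF _ d'(2)[of "x - y"]] 3 y by simp
        moreover have "integral {a..y} f - integral {a..x} f - (y - x) *\<^sub>R f x = - (integral {a..x} f - integral {a..y} f - (x - y) *\<^sub>R f x)"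
          by (simp add: algebra_simps)
        ultimately show ?thesis using 3 by (simp only: norm_minus_cancel real_norm_def) simp
      qed simp
    qed (use d d' \<open>a < x\<close> in auto)
  qed
  ultimately show thesis by (rule that)
qed

lemma abs_continuous_eq_integral:
  fixes v :: "real \<Rightarrow> 'a::euclidean_space"
  assumes ac: "abs_continuous_on_interval a b v" and "a \<le> b"
  obtains f N where "f \<in> borel_measurable borel" "integrable lborel f"
    "\<And>x. x \<in> {a..b} \<Longrightarrow> v x = v a + integral {a..x} f"
    "negligible N" "\<And>x. x \<in> {a<..<b} - N \<Longrightarrow> (v has_vector_derivative f x) (at x)"
proof -
  have "\<exists>g. g \<in> borel_measurable borel \<and> integrable lborel g \<and>
      (\<forall>x\<in>{a..b}. v x \<bullet> i = v a \<bullet> i + integral {a..x} g)" if "i \<in> Basis" for i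
  proof -
    have "abs_continuous_on_interval a b (\<lambda>x. v x \<bullet> i)"
      unfolding abs_continuous_on_interval_def
    proof (intro allI impI)
      fix e :: real assume "0 < e"
      then obtain \<delta> where \<delta>: "0 < \<delta>" "\<And>D U. \<lbrakk>intervals_in U a b D; (\<Sum>(c, d)\<in>D. d - c) < \<delta>\<rbrakk> \<Longrightarrow> osc_sum v D < e"
        using abs_continuous_on_intervalD[OF ac] by blast
      have "(\<Sum>(c, d)\<in>D. norm (v d \<bullet> i - v c \<bullet> i)) < e"
        if D: "finite D" "\<forall>(c, d)\<in>D. a \<le> c \<and> c \<le> d \<and> d \<le> b" "disjoint_family_on (\<lambda>(c, d). {c<..<d}) D"
          "(\<Sum>(c, d)\<in>D. d - c) < \<delta>" for D
      proof -
        have "norm (v d \<bullet> i - v c \<bullet> i) \<le> norm (v d - v c)" for c d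
          using Basis_le_norm[OF \<open>i \<in> Basis\<close>, of "v d - v c"] by (simp add: inner_diff_left)
        then have "(\<Sum>(c, d)\<in>D. norm (v d \<bullet> i - v c \<bullet> i)) \<le> osc_sum v D"
          unfolding osc_sum_def by (intro sum_mono) auto
        also have "osc_sum v D < e" by (rule \<delta>(2)[of UNIV]) (use D in \<open>auto simp: intervals_in_def\<close>)
        finally show ?thesis .
      qed
      then show "\<exists>\<delta>>0. \<forall>D. finite D \<longrightarrow> (\<forall>(c, d)\<in>D. a \<le> c \<and> c \<le> d \<and> d \<le> b) \<longrightarrow>
        disjoint_family_on (\<lambda>(c, d). {c<..<d}) D \<longrightarrow> (\<Sum>(c, d)\<in>D. d - c) < \<delta> \<longrightarrow>
        (\<Sum>(c, d)\<in>D. norm (v d \<bullet> i - v c \<bullet> i)) < e" using \<delta>(1) by blast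
    qed
    from abs_continuous_real_eq_integral[OF this \<open>a \<le> b\<close>] show ?thesis by metis
  qed
  then obtain g where g: "\<And>i. i \<in> Basis \<Longrightarrow> g i \<in> borel_measurable borel"
    "\<And>i. i \<in> Basis \<Longrightarrow> integrable lborel (g i)"
    "\<And>i x. \<lbrakk>i \<in> Basis; x \<in> {a..b}\<rbrakk> \<Longrightarrow> v x \<bullet> i = v a \<bullet> i + integral {a..x} (g i)"
    by metis
  define f where "f x = (\<Sum>i\<in>Basis. g i x *\<^sub>R i)" for x
  have f: "f \<in> borel_measurable borel" "integrable lborel f"
    unfolding f_def using g(1,2) by (auto intro!: Bochner_Integration.integrable_sum)
  have io: "f integrable_on {x..y}" for x y
    using integrable_on_subinterval[OF integrable_on_lborel[OF f(2)]] by simp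
  have eq: "v x = v a + integral {a..x} f" if "x \<in> {a..b}" for x
  proof (rule euclidean_eqI)
    fix i :: 'a assume i: "i \<in> Basis"
    have "(\<lambda>x. f x \<bullet> i) = g i" using i by (auto simp: f_def)
    then show "v x \<bullet> i = (v a + integral {a..x} f) \<bullet> i"
      using g(3)[OF i that] integral_component_eq[OF io, of a x i] by (simp add: inner_add_left)
  qed
  obtain N where N: "negligible N" "\<And>a x. \<lbrakk>a < x; x \<notin> N\<rbrakk> \<Longrightarrow> ((\<lambda>y. integral {a..y} f) has_vector_derivative f x) (at x)"
    by (rule indefinite_integral_has_vector_derivative_ae[OF io]) (rule that, assumption+)
  have "(v has_vector_derivative f x) (at x)" if "x \<in> {a<..<b} - N" for x
  proof (rule has_vector_derivative_transform_within_open)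
    show "((\<lambda>y. v a + integral {a..y} f) has_vector_derivative f x) (at x)"
      using has_vector_derivative_add[OF has_vector_derivative_const N(2)[of a x]] that by simp
    show "open {a<..<b}" "x \<in> {a<..<b}" using that by auto
    show "v a + integral {a..y} f = v y" if "y \<in> {a<..<b}" for y using eq[of y] that by simp
  qed
  with f eq N(1) show thesis by (rule that)
qed

section \<open>Affine competitors and the action integral\<close>

lemma abs_continuous_on_intervalI:
  assumes "\<And>\<epsilon>. 0 < \<epsilon> \<Longrightarrow> \<exists>\<delta>>0. \<forall>D. intervals_in UNIV a b D \<longrightarrow> (\<Sum>(c, d)\<in>D. d - c) < \<delta> \<longrightarrow> osc_sum w D < \<epsilon>"
  shows "abs_continuous_on_interval a b w"
  unfolding abs_continuous_on_interval_def
proof (intro allI impI)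
  fix \<epsilon> :: real assume "0 < \<epsilon>"
  then obtain \<delta> where \<delta>: "0 < \<delta>" "\<And>D. \<lbrakk>intervals_in UNIV a b D; (\<Sum>(c, d)\<in>D. d - c) < \<delta>\<rbrakk> \<Longrightarrow> osc_sum w D < \<epsilon>"
    using assms by meson
  show "\<exists>\<delta>>0. \<forall>D. finite D \<longrightarrow> (\<forall>(c, d)\<in>D. a \<le> c \<and> c \<le> d \<and> d \<le> b) \<longrightarrow>
      disjoint_family_on (\<lambda>(c, d). {c<..<d}) D \<longrightarrow> (\<Sum>(c, d)\<in>D. d - c) < \<delta> \<longrightarrow>
      (\<Sum>(c, d)\<in>D. norm (w d - w c)) < \<epsilon>"
    using \<delta> by (intro exI[of _ \<delta>]) (auto simp: intervals_in_def osc_sum_def)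
qed

text \<open>The modified function is the sum of \<open>v\<close> stopped at \<open>c\<close>, an affine function of the clamped variable,
and \<open>v\<close> started at \<open>d\<close>; composition with a monotone map that does not increase distances preserves
absolute continuity.\<close>
lemma abs_continuous_replace_affine:
  fixes v :: "real \<Rightarrow> 'a::real_normed_vector"
  assumes ac: "abs_continuous_on_interval a b v" and cd: "a \<le> c" "c < d" "d \<le> b"
  defines "p \<equiv> (v d - v c) /\<^sub>R (d - c)"
  shows "abs_continuous_on_interval a b (\<lambda>x. if x \<in> {c..d} then v c + (x - c) *\<^sub>R p else v x)"
proof (rule abs_continuous_on_intervalI)
  let ?u = "\<lambda>x. if x \<in> {c..d} then v c + (x - c) *\<^sub>R p else v x"
  define l r where "l x = min x c" and "r x = max x d" for x :: real
  define k where "k x = max c (min x d)" for x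
  have pd: "(d - c) *\<^sub>R p = v d - v c" using cd by (simp add: p_def)
  have u: "?u x = v (l x) + (k x - c) *\<^sub>R p + (v (r x) - v d)" for x
    using cd pd by (auto simp: l_def r_def k_def max_def min_def)
  have mono: "mono l" "mono r" by (auto simp: l_def r_def mono_def)
  fix \<epsilon> :: real assume "0 < \<epsilon>"
  then obtain \<delta> where \<delta>: "0 < \<delta>" "\<And>D U. \<lbrakk>intervals_in U a b D; (\<Sum>(c, d)\<in>D. d - c) < \<delta>\<rbrakk> \<Longrightarrow> osc_sum v D < \<epsilon> / 3"
    using abs_continuous_on_intervalD[OF ac, of "\<epsilon> / 3"] by auto
  define \<delta>' where "\<delta>' = min \<delta> (\<epsilon> / 3 / (norm p + 1))"
  have "osc_sum ?u D < \<epsilon>" if D: "intervals_in UNIV a b D" and len: "(\<Sum>(c, d)\<in>D. d - c) < \<delta>'" for D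
  proof -
    have D': "a \<le> x \<and> x \<le> y \<and> y \<le> b" if "(x, y) \<in> D" for x y
      using D that by (auto simp: intervals_in_def)
    have small: "osc_sum (v \<circ> h) D < \<epsilon> / 3" if h: "mono h" "\<And>x. x \<in> {a..b} \<Longrightarrow> h x \<in> {a..b}"
      "\<And>x y. x \<le> y \<Longrightarrow> h y - h x \<le> y - x" for h
    proof -
      let ?D = "(\<lambda>(x, y). (h x, h y)) ` D"
      have hD: "a \<le> h x \<and> h y \<le> b \<and> {h x<..<h y} \<subseteq> UNIV" if "(x, y) \<in> D" for x y
        using D'[OF that] h(2)[of x] h(2)[of y] by auto
      have I: "intervals_in UNIV a b ?D" by (rule intervals_in_map(1)[OF D h(1) hD])
      have "(\<Sum>(x, y)\<in>?D. y - x) = osc_sum (\<lambda>x. x) ?D"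
        unfolding osc_sum_def using I by (intro sum.cong) (auto simp: intervals_in_def)
      also have "\<dots> = osc_sum ((\<lambda>x. x) \<circ> h) D" by (rule intervals_in_map(2)[OF D h(1) hD])
      also have "\<dots> \<le> (\<Sum>(x, y)\<in>D. y - x)"
        unfolding osc_sum_def
      proof (rule sum_mono, clarsimp)
        fix x y assume "(x, y) \<in> D"
        then show "\<bar>h y - h x\<bar> \<le> y - x" using D'[of x y] monoD[OF h(1), of x y] h(3)[of x y] by simp
      qed
      finally have "osc_sum v ?D < \<epsilon> / 3" using \<delta>(2)[OF I] len by (simp add: \<delta>'_def)
      then show ?thesis using intervals_in_map(2)[OF D h(1) hD, of v] by simp
    qed
    have "osc_sum ?u D \<le> osc_sum (v \<circ> l) D + norm p * (\<Sum>(x, y)\<in>D. y - x) + osc_sum (v \<circ> r) D"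
      unfolding osc_sum_def sum_distrib_left sum.distrib[symmetric]
    proof (rule sum_mono, clarify)
      fix x y assume "(x, y) \<in> D"
      then have xy: "x \<le> y" using D' by auto
      have "?u y - ?u x = (v (l y) - v (l x)) + (k y - k x) *\<^sub>R p + (v (r y) - v (r x))"
        unfolding u by (simp add: algebra_simps)
      also have "norm \<dots> \<le> norm (v (l y) - v (l x)) + norm ((k y - k x) *\<^sub>R p) + norm (v (r y) - v (r x))"
        by (intro order_trans[OF norm_triangle_ineq] add_mono norm_triangle_ineq order_refl)
      also have "norm ((k y - k x) *\<^sub>R p) \<le> norm p * (y - x)"
        using xy mult_right_mono[of "\<bar>k y - k x\<bar>" "y - x" "norm p"] by (auto simp: k_def mult.commute)
      finally show "norm (?u y - ?u x) \<le> norm ((v \<circ> l) y - (v \<circ> l) x) + norm p * (y - x) + norm ((v \<circ> r) y - (v \<circ> r) x)"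
        by simp
    qed
    moreover have "osc_sum (v \<circ> l) D < \<epsilon> / 3" "osc_sum (v \<circ> r) D < \<epsilon> / 3"
      by (rule small[OF mono(1)]; use cd in \<open>auto simp: l_def\<close>)
         (rule small[OF mono(2)]; use cd in \<open>auto simp: r_def\<close>)
    moreover have "norm p * (\<Sum>(x, y)\<in>D. y - x) \<le> \<epsilon> / 3"
    proof -
      have "0 \<le> (\<Sum>(x, y)\<in>D. y - x)" by (rule sum_nonneg) (use D' in auto)
      then have "norm p * (\<Sum>(x, y)\<in>D. y - x) \<le> (norm p + 1) * (\<Sum>(x, y)\<in>D. y - x)" by (simp add: algebra_simps)
      also have "\<dots> \<le> (norm p + 1) * (\<epsilon> / 3 / (norm p + 1))"
        using len by (intro mult_left_mono) (auto simp: \<delta>'_def)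
      also have "\<dots> = \<epsilon> / 3"
        using norm_ge_zero[of p] by (subst times_divide_eq_right, subst nonzero_mult_div_cancel_left) linarith+
      finally show ?thesis .
    qed
    ultimately show ?thesis by linarith
  qed
  moreover have "\<delta>' > 0" using \<delta>(1) \<open>0 < \<epsilon>\<close> norm_ge_zero[of p] by (auto simp: \<delta>'_def intro!: divide_pos_pos add_nonneg_pos)
  ultimately show "\<exists>\<delta>>0. \<forall>D. intervals_in UNIV a b D \<longrightarrow> (\<Sum>(c, d)\<in>D. d - c) < \<delta> \<longrightarrow> osc_sum ?u D < \<epsilon>"
    by blast
qed

text \<open>Closeness of \<open>\<phi>\<close> and \<open>\<phi>0\<close> is only known on a ball around \<open>p\<close>. On its boundary sphere the gap of \<open>\<phi>0\<close>
survives up to \<open>\<epsilon>\<close>, and from there convexity of \<open>\<phi>\<close> carries it outwards along rays: \<open>\<phi>\<close> minus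
the affine function is larger on the sphere than at \<open>p\<close>, hence at least as large beyond. Thus the error
does not depend on the size of \<open>q\<close>.\<close>
lemma gap_stable_under_perturbation:
  fixes \<phi> \<phi>0 :: "'a::real_inner \<Rightarrow> real"
  assumes "0 < r" "0 \<le> \<epsilon>" "\<epsilon> \<le> \<tau>"
    and sub: "is_subgradient \<phi>0 p \<xi>"
    and gap: "\<And>q. norm (q - p) = r \<Longrightarrow> \<phi>0 p + \<xi> \<bullet> (q - p) + 2 * \<tau> \<le> \<phi>0 q"
    and close: "\<And>q. norm (q - p) \<le> r \<Longrightarrow> \<bar>\<phi> q - \<phi>0 q\<bar> \<le> \<epsilon>"
    and convex: "\<And>z. \<exists>\<eta>. is_subgradient \<phi> z \<eta>"
  shows "\<phi>0 p + \<xi> \<bullet> (q - p) - \<epsilon> + (if r \<le> norm (q - p) then 2 * \<tau> else 0) \<le> \<phi> q"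
proof (cases "r \<le> norm (q - p)")
  case False
  then show ?thesis using close[of q] sub unfolding is_subgradient_def by (auto simp: abs_le_iff) (smt (verit))
next
  case True
  define \<mu> where "\<mu> = norm (q - p) / r - 1"
  \<comment> \<open>the point where the segment from \<open>p\<close> to \<open>q\<close> crosses the sphere\<close>
  define z where "z = p + (r / norm (q - p)) *\<^sub>R (q - p)"
  have n0: "norm (q - p) > 0" by (rule less_le_trans[OF \<open>0 < r\<close> True])
  have \<mu>: "0 \<le> \<mu>" using True \<open>0 < r\<close> by (simp add: \<mu>_def field_simps)
  have nz: "norm (z - p) = r" using n0 \<open>0 < r\<close> by (simp add: z_def)
  have "(1 + \<mu>) * (r / norm (q - p)) = 1" using n0 \<open>0 < r\<close> by (simp add: \<mu>_def)
  moreover have "(1 + \<mu>) *\<^sub>R (z - p) = ((1 + \<mu>) * (r / norm (q - p))) *\<^sub>R (q - p)"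
    unfolding z_def by (simp only: add_diff_cancel_left' scaleR_scaleR)
  ultimately have qp: "q - p = (1 + \<mu>) *\<^sub>R (z - p)" by (simp only: scaleR_one)
  then have qz: "q - z = \<mu> *\<^sub>R (z - p)" by (simp add: algebra_simps)
  obtain \<eta> where "is_subgradient \<phi> z \<eta>" using convex by blast
  then have "\<phi> z + \<eta> \<bullet> (q - z) \<le> \<phi> q" and "\<phi> z + \<eta> \<bullet> (p - z) \<le> \<phi> p" by (auto simp: is_subgradient_def)
  then have q: "\<phi> z + \<mu> * (\<eta> \<bullet> (z - p)) \<le> \<phi> q" and p: "\<phi> z - \<phi> p \<le> \<eta> \<bullet> (z - p)"
    by (simp_all add: qz inner_diff_right)
  have zlow: "\<phi>0 p + \<xi> \<bullet> (z - p) + 2 * \<tau> - \<epsilon> \<le> \<phi> z" using gap[OF nz] close[of z] nz by simp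
  have "\<phi> p \<le> \<phi>0 p + \<epsilon>" using close[of p] \<open>0 < r\<close> by simp
  then have "\<xi> \<bullet> (z - p) \<le> \<eta> \<bullet> (z - p)" using p zlow \<open>\<epsilon> \<le> \<tau>\<close> by simp
  then have "\<mu> * (\<xi> \<bullet> (z - p)) \<le> \<mu> * (\<eta> \<bullet> (z - p))" using \<mu> by (rule mult_left_mono)
  moreover have "\<xi> \<bullet> (q - p) = \<xi> \<bullet> (z - p) + \<mu> * (\<xi> \<bullet> (z - p))"
    unfolding qp by (simp add: algebra_simps)
  ultimately show ?thesis using q zlow True by simp
qed

lemma SC_imp_subgradient:
  fixes L :: "real \<times> 'a::real_inner \<times> 'a \<Rightarrow> real"
  assumes SC: "strict_convexity_SC a b L" and t: "t \<in> {a..b}"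
  shows "\<exists>\<xi>. is_subgradient (\<lambda>q. L (t, y, q)) p \<xi>"
proof -
  define R where "R = max 1 (max \<bar>t\<bar> (max (norm y) (norm p)))"
  have R: "1 \<le> R" "max \<bar>t\<bar> (max (norm y) (norm p)) \<le> R + 1" by (auto simp: R_def)
  show ?thesis using SC[unfolded strict_convexity_SC_def, rule_format, OF R(1)] t R(2) by blast
qed

text \<open>A subgradient at velocity \<open>0\<close> is bounded by the oscillation of \<open>L\<close> over the unit ball of velocities,
uniformly on compact sets of \<open>(t, y)\<close>. This bound keeps the negative part of the action finite.\<close>
lemma SC_imp_linear_lower_bound:
  fixes L :: "real \<times> 'a::euclidean_space \<times> 'a \<Rightarrow> real"
  assumes SC: "strict_convexity_SC a b L" and cont: "continuous_on ({a..b} \<times> UNIV \<times> UNIV) L"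
  obtains M where "0 \<le> M" "\<And>t y q. \<lbrakk>t \<in> {a..b}; norm y \<le> B\<rbrakk> \<Longrightarrow> - M - M * norm q \<le> L (t, y, q)"
proof -
  have "compact ({a..b} \<times> cball (0::'a) B \<times> cball (0::'a) 1)" by (intro compact_Times) auto
  moreover have "continuous_on ({a..b} \<times> cball (0::'a) B \<times> cball (0::'a) 1) L" by (rule continuous_on_subset[OF cont]) auto
  ultimately have "bounded (L ` ({a..b} \<times> cball (0::'a) B \<times> cball (0::'a) 1))"
    by (intro compact_imp_bounded compact_continuous_image)
  then obtain M where M: "0 < M" "\<And>z. z \<in> {a..b} \<times> cball (0::'a) B \<times> cball (0::'a) 1 \<Longrightarrow> \<bar>L z\<bar> \<le> M"
    unfolding bounded_pos by auto
  have "- (2 * M) - 2 * M * norm q \<le> L (t, y, q)" if t: "t \<in> {a..b}" and y: "norm y \<le> B" for t y q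
  proof -
    obtain \<xi> where \<xi>: "\<And>q. L (t, y, 0) + \<xi> \<bullet> q \<le> L (t, y, q)"
      using SC_imp_subgradient[OF SC t, of y 0] by (auto simp: is_subgradient_def)
    have "\<xi> \<bullet> sgn \<xi> = norm \<xi>" by (cases "\<xi> = 0") (simp_all add: sgn_div_norm dot_square_norm power2_eq_square)
    moreover have "\<bar>L (t, y, sgn \<xi>)\<bar> \<le> M" "\<bar>L (t, y, 0)\<bar> \<le> M"
      using M(2)[of "(t, y, sgn \<xi>)"] M(2)[of "(t, y, 0)"] t y by (auto simp: norm_sgn)
    ultimately have "norm \<xi> \<le> 2 * M" using \<xi>[of "sgn \<xi>"] by linarith
    have "- (norm \<xi> * norm q) \<le> \<xi> \<bullet> q" using Cauchy_Schwarz_ineq2[of \<xi> q] by linarith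
    moreover have "norm \<xi> * norm q \<le> 2 * M * norm q" using \<open>norm \<xi> \<le> 2 * M\<close> by (intro mult_right_mono) auto
    ultimately show ?thesis using \<xi>[of q] \<open>\<bar>L (t, y, 0)\<bar> \<le> M\<close> M(1) by linarith
  qed
  then show thesis using that[of "2 * M"] M(1) by simp
qed

text \<open>Clamping the time variable to \<open>[a, b]\<close> extends \<open>L\<close> and \<open>u\<close> to globally continuous functions, so that
the composition with a Borel function is Borel.\<close>
lemma integrand_borel_measurable:
  fixes L :: "real \<times> 'a::euclidean_space \<times> 'a \<Rightarrow> real"
  assumes "a \<le> b" and L: "continuous_on ({a..b} \<times> UNIV \<times> UNIV) L"
    and u: "continuous_on {a..b} u" and f: "f \<in> borel_measurable borel"
  obtains g where "g \<in> borel_measurable borel" "\<And>t. t \<in> {a..b} \<Longrightarrow> g t = L (t, u t, f t)"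
proof -
  define p where "p t = max a (min b t)" for t
  have p: "p t \<in> {a..b}" for t using \<open>a \<le> b\<close> by (auto simp: p_def)
  have pc: "continuous_on UNIV p" unfolding p_def by (intro continuous_intros)
  have "continuous_on UNIV (\<lambda>(t, y, q). L (p t, y, q))"
    unfolding case_prod_unfold
    by (rule continuous_on_compose2[OF L]) (use p in \<open>auto intro!: continuous_intros continuous_on_compose2[OF pc]\<close>)
  then have [measurable]: "(\<lambda>(t, y, q). L (p t, y, q)) \<in> borel_measurable borel"
    by (rule borel_measurable_continuous_onI)
  have "continuous_on UNIV (\<lambda>t. u (p t))" by (rule continuous_on_compose2[OF u pc]) (use p in auto)
  then have [measurable]: "(\<lambda>t. u (p t)) \<in> borel_measurable borel" by (rule borel_measurable_continuous_onI)
  note f[measurable]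
  have "(\<lambda>t. (t, u (p t), f t)) \<in> borel_measurable borel" by (intro borel_measurable_Pair) measurable
  then have "(\<lambda>t. (\<lambda>(t, y, q). L (p t, y, q)) (t, u (p t), f t)) \<in> borel_measurable borel"
    by (rule measurable_compose) measurable
  then have "(\<lambda>t. L (p t, u (p t), f t)) \<in> borel_measurable borel" by simp
  then show thesis by (rule that) (auto simp: p_def)
qed

text \<open>Replacing the derivative by a Borel representative \<open>g\<close> of the integrand moves the action from the
completed measure to the Borel one, where measurability is automatic.\<close>
lemma action_eq_nn_integral:
  assumes g: "g \<in> borel_measurable borel" and N: "negligible N"
    and eq: "\<And>t. t \<in> {a<..<b} - N \<Longrightarrow> L (t, u t, vector_derivative u (at t)) = g t"
  defines "h \<equiv> \<lambda>t. indicator {a<..<b} t * g t"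
  shows "action L a b u = enn2ereal (\<integral>\<^sup>+t. ennreal (h t) \<partial>lborel) - enn2ereal (\<integral>\<^sup>+t. ennreal (- h t) \<partial>lborel)"
proof -
  have [measurable]: "h \<in> borel_measurable borel" using g unfolding h_def by measurable
  have ae: "AE t in lebesgue. t \<notin> N"
    using N by (simp add: negligible_iff_null_sets AE_not_in)
  have "(\<integral>\<^sup>+t\<in>{a<..<b}. ennreal (s * L (t, u t, vector_derivative u (at t))) \<partial>lebesgue) = (\<integral>\<^sup>+t. ennreal (s * h t) \<partial>lborel)" for s
  proof -
    have "(\<integral>\<^sup>+t\<in>{a<..<b}. ennreal (s * L (t, u t, vector_derivative u (at t))) \<partial>lebesgue) = (\<integral>\<^sup>+t. ennreal (s * h t) \<partial>lebesgue)"
    proof (rule nn_integral_cong_AE, use ae in eventually_elim)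
      fix t assume "t \<notin> N"
      then show "ennreal (s * L (t, u t, vector_derivative u (at t))) * indicator {a<..<b} t = ennreal (s * h t)"
        using eq[of t] by (cases "t \<in> {a<..<b}") (simp_all add: h_def)
    qed
    also have "\<dots> = (\<integral>\<^sup>+t. ennreal (s * h t) \<partial>lborel)" by (rule nn_integral_completion)
    finally show ?thesis .
  qed
  from this[of 1] this[of "-1"] show ?thesis unfolding action_def by simp
qed

lemma action_eq_integral:
  assumes g: "g \<in> borel_measurable borel" and N: "negligible N"
    and eq: "\<And>t. t \<in> {a<..<b} - N \<Longrightarrow> L (t, u t, vector_derivative u (at t)) = g t"
    and int: "integrable lborel (\<lambda>t. indicator {a<..<b} t * g t)"
  shows "action L a b u = ereal (\<integral>t. indicator {a<..<b} t * g t \<partial>lborel)"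
proof -
  let ?h = "\<lambda>t. indicator {a<..<b} t * g t"
  obtain r q where rq: "0 \<le> r" "0 \<le> q" "(\<integral>\<^sup>+t. ennreal (?h t) \<partial>lborel) = ennreal r"
      "(\<integral>\<^sup>+t. ennreal (- ?h t) \<partial>lborel) = ennreal q" "(\<integral>t. ?h t \<partial>lborel) = r - q"
    by (rule integrableE[OF int]) (rule that, assumption+)
  show ?thesis
    by (subst action_eq_nn_integral[where L = L and u = u, OF g N eq]) (simp_all add: rq enn2ereal_ennreal)
qed

lemma integrable_if_action_finite:
  assumes g: "g \<in> borel_measurable borel" and N: "negligible N"
    and eq: "\<And>t. t \<in> {a<..<b} - N \<Longrightarrow> L (t, u t, vector_derivative u (at t)) = g t"
    and k: "integrable lborel k" "\<And>t. t \<in> {a<..<b} \<Longrightarrow> - k t \<le> g t" "\<And>t. 0 \<le> k t"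
    and fin: "action L a b u < \<infinity>"
  shows "integrable lborel (\<lambda>t. indicator {a<..<b} t * g t)"
proof -
  let ?h = "\<lambda>t. indicator {a<..<b} t * g t"
  have "(\<integral>\<^sup>+t. ennreal (- ?h t) \<partial>lborel) \<le> (\<integral>\<^sup>+t. ennreal (k t) \<partial>lborel)"
    by (rule nn_integral_mono) (use k(2,3) in \<open>force simp: indicator_def intro!: ennreal_leI\<close>)
  also have "\<dots> < \<infinity>" using k by (auto simp: integrable_iff_bounded)
  finally have neg: "(\<integral>\<^sup>+t. ennreal (- ?h t) \<partial>lborel) < \<infinity>" .
  have pos: "(\<integral>\<^sup>+t. ennreal (?h t) \<partial>lborel) < \<infinity>"
  proof (rule ccontr)
    assume "\<not> ?thesis"
    then have "(\<integral>\<^sup>+t. ennreal (?h t) \<partial>lborel) = \<infinity>" by (simp add: not_less top_unique)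
    moreover obtain q where "0 \<le> q" "(\<integral>\<^sup>+t. ennreal (- ?h t) \<partial>lborel) = ennreal q"
      using neg by (cases "\<integral>\<^sup>+t. ennreal (- ?h t) \<partial>lborel") auto
    ultimately have "action L a b u = \<infinity>"
      by (subst action_eq_nn_integral[where L = L and u = u, OF g N eq]) (simp_all add: enn2ereal_ennreal)
    then show False using fin by simp
  qed
  show ?thesis
    using g pos neg by (auto simp: real_integrable_def)
qed

section \<open>Minimizers on short intervals\<close>

lemma integrable_indicator_mult_bounded:
  fixes g :: "real \<Rightarrow> real"
  assumes g: "g \<in> borel_measurable borel" and M: "\<And>t. t \<in> {a<..<b} \<Longrightarrow> \<bar>g t\<bar> \<le> M"
  shows "integrable lborel (\<lambda>t. indicator {a<..<b} t * g t)"
proof (rule Bochner_Integration.integrable_bound)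
  show "integrable lborel (\<lambda>t. M * indicator {a<..<b} t)"
    by (cases "a \<le> b") (auto intro!: integrable_mult_right)
  show "AE t in lborel. norm (indicator {a<..<b} t * g t) \<le> norm (M * indicator {a<..<b} t)"
    using M by (intro AE_I2) (force simp: indicator_def)
qed (use g in measurable)

lemma indicator_integral_eq:
  fixes g :: "real \<Rightarrow> real"
  assumes "integrable lborel (\<lambda>t. indicator {c<..<d} t * g t)"
  shows "g integrable_on {c..d}" "(\<integral>t. indicator {c<..<d} t * g t \<partial>lborel) = integral {c..d} g"
proof -
  have s: "set_integrable lborel {c<..<d} g" using assms by (simp add: set_integrable_def)
  show "g integrable_on {c..d}"
    using set_borel_integral_eq_integral(1)[OF s] by (simp add: integrable_on_open_interval_real)
  show "(\<integral>t. indicator {c<..<d} t * g t \<partial>lborel) = integral {c..d} g"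
    using set_borel_integral_eq_integral(2)[OF s] by (simp add: set_lebesgue_integral_def integral_open_interval_real)
qed

lemma vector_derivative_replace_affine:
  fixes v :: "real \<Rightarrow> 'a::real_normed_vector"
  assumes "t \<in> {c<..<d}"
  shows "vector_derivative (\<lambda>x. if x \<in> {c..d} then v c + (x - c) *\<^sub>R p else v x) (at t) = p"
proof (rule vector_derivative_at, rule has_vector_derivative_transform_within_open)
  show "((\<lambda>x. v c + (x - c) *\<^sub>R p) has_vector_derivative p) (at t)"
    by (auto intro!: derivative_eq_intros)
  show "open {c<..<d}" by simp
qed (use assms in auto)

text \<open>In what follows \<open>f\<close> is a Borel version of \<open>v'\<close> and \<open>g\<close> a Borel version of the integrand along the
minimizer \<open>v\<close>.\<close>
context
  fixes a b :: real and L :: "real \<times> 'a::euclidean_space \<times> 'a \<Rightarrow> real" and v f :: "real \<Rightarrow> 'a"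
    and N :: "real set" and g :: "real \<Rightarrow> real"
  assumes ab: "a < b" and L: "continuous_on ({a..b} \<times> UNIV \<times> UNIV) L"
    and SC: "strict_convexity_SC a b L" and min: "is_minimizer L a b v"
    and f: "f \<in> borel_measurable borel" "integrable lborel f"
    and N: "negligible N" and vf: "\<And>t. t \<in> {a<..<b} - N \<Longrightarrow> (v has_vector_derivative f t) (at t)"
    and g: "g \<in> borel_measurable borel" "\<And>t. t \<in> {a..b} \<Longrightarrow> g t = L (t, v t, f t)"
begin

text \<open>The affine competitor has a bounded integrand and so a finite action. Hence the action of the
minimizer is not \<open>\<infinity>\<close>, and the linear lower bound for \<open>L\<close> makes its negative part finite.\<close>
lemma minimizer_integrable: "integrable lborel (\<lambda>t. indicator {a<..<b} t * g t)"
proof -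
  have ac: "abs_continuous_on_interval a b v" using min by (simp add: is_minimizer_def admissible_def)
  have vc: "continuous_on {a..b} v" by (rule abs_continuous_imp_continuous[OF ac])
  define p where "p = (v b - v a) /\<^sub>R (b - a)"
  define u where "u = (\<lambda>x. if x \<in> {a..b} then v a + (x - a) *\<^sub>R p else v x)"
  have uac: "abs_continuous_on_interval a b u"
    unfolding u_def p_def by (rule abs_continuous_replace_affine[OF ac order_refl ab order_refl])
  have "u a = v a" "u b = v b" using ab by (simp_all add: u_def p_def)
  then have uadm: "u \<in> admissible a b (v a) (v b)" using uac by (simp add: admissible_def)
  have uc: "continuous_on {a..b} u" by (rule abs_continuous_imp_continuous[OF uac])
  obtain h where h: "h \<in> borel_measurable borel" "\<And>t. t \<in> {a..b} \<Longrightarrow> h t = L (t, u t, p)"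
    using ab by (rule integrand_borel_measurable[OF less_imp_le L uc, of "\<lambda>_. p"]) (simp, rule that, assumption+)
  have "continuous_on {a..b} (\<lambda>t. L (t, u t, p))"
    by (rule continuous_on_compose2[OF L]) (auto intro!: continuous_intros uc)
  then have "bounded ((\<lambda>t. L (t, u t, p)) ` {a..b})" by (intro compact_imp_bounded compact_continuous_image) auto
  then obtain M where "\<forall>z\<in>(\<lambda>t. L (t, u t, p)) ` {a..b}. norm z \<le> M" unfolding bounded_iff by blast
  then have M: "\<bar>L (t, u t, p)\<bar> \<le> M" if "t \<in> {a..b}" for t using that by auto
  have "action L a b u = ereal (\<integral>t. indicator {a<..<b} t * h t \<partial>lborel)"
  proof (rule action_eq_integral[OF h(1) negligible_empty])
    show "L (t, u t, vector_derivative u (at t)) = h t" if "t \<in> {a<..<b} - {}" for t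
      using that vector_derivative_replace_affine[of t a b v p] h(2)[of t] by (simp add: u_def)
    show "integrable lborel (\<lambda>t. indicator {a<..<b} t * h t)"
      by (rule integrable_indicator_mult_bounded[OF h(1), where M = M]) (use h(2) M in auto)
  qed
  then have fin: "action L a b v < \<infinity>"
    using min uadm unfolding is_minimizer_def by (metis ereal_infty_less(1) le_less_trans less_ereal.simps(4) ereal_less_PInfty)
  have "bounded (v ` {a..b})" by (intro compact_imp_bounded compact_continuous_image[OF vc]) auto
  then obtain B where "\<forall>z\<in>v ` {a..b}. norm z \<le> B" unfolding bounded_iff by blast
  then have B: "norm (v t) \<le> B" if "t \<in> {a..b}" for t using that by auto
  obtain M' where M': "0 \<le> M'" "\<And>t y q. \<lbrakk>t \<in> {a..b}; norm y \<le> B\<rbrakk> \<Longrightarrow> - M' - M' * norm q \<le> L (t, y, q)"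
    by (rule SC_imp_linear_lower_bound[OF SC L, of B]) (rule that, assumption+)
  define k where "k t = indicator {a<..<b} t * M' + M' * norm (f t)" for t
  show ?thesis
  proof (rule integrable_if_action_finite[where L = L and u = v, OF g(1) N _ _ _ _ fin])
    show "L (t, v t, vector_derivative v (at t)) = g t" if "t \<in> {a<..<b} - N" for t
      using vector_derivative_at[OF vf[OF that]] g(2)[of t] that by simp
    show "integrable lborel k"
      unfolding k_def using f(2) ab by (intro Bochner_Integration.integrable_add integrable_mult_right integrable_mult_left integrable_norm) auto
    show "- k t \<le> g t" if "t \<in> {a<..<b}" for t
      using M'(2)[of t "v t" "f t"] B[of t] g(2)[of t] that by (simp add: k_def)
    show "0 \<le> k t" for t using M'(1) by (simp add: k_def)
  qed
qed

text \<open>Outside \<open>[c, d]\<close> the competitor has the same integrand as \<open>v\<close>. Integrability along \<open>v\<close> allows the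
common part to be cancelled from the inequality between the actions.\<close>
lemma minimizer_le_affine_on_subinterval:
  assumes cd: "a \<le> c" "c < d" "d \<le> b"
  defines "p \<equiv> (v d - v c) /\<^sub>R (d - c)"
  shows "g integrable_on {c..d}"
    and "integral {c..d} g \<le> integral {c..d} (\<lambda>t. L (t, v c + (t - c) *\<^sub>R p, p))"
proof -
  have ac: "abs_continuous_on_interval a b v" using min by (simp add: is_minimizer_def admissible_def)
  define u where "u = (\<lambda>x. if x \<in> {c..d} then v c + (x - c) *\<^sub>R p else v x)"
  have uac: "abs_continuous_on_interval a b u"
    unfolding u_def p_def by (rule abs_continuous_replace_affine[OF ac cd])
  have "u a = v a" "u b = v b" using cd by (auto simp: u_def p_def)
  then have uadm: "u \<in> admissible a b (v a) (v b)" using uac by (simp add: admissible_def)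
  have uc: "continuous_on {a..b} u" by (rule abs_continuous_imp_continuous[OF uac])
  obtain h where h: "h \<in> borel_measurable borel" "\<And>t. t \<in> {a..b} \<Longrightarrow> h t = L (t, u t, p)"
    using ab by (rule integrand_borel_measurable[OF less_imp_le L uc, of "\<lambda>_. p"]) (simp, rule that, assumption+)
  have "continuous_on {a..b} (\<lambda>t. L (t, u t, p))"
    by (rule continuous_on_compose2[OF L]) (auto intro!: continuous_intros uc)
  then have "bounded ((\<lambda>t. L (t, u t, p)) ` {a..b})" by (intro compact_imp_bounded compact_continuous_image) auto
  then obtain M where "\<forall>z\<in>(\<lambda>t. L (t, u t, p)) ` {a..b}. norm z \<le> M" unfolding bounded_iff by blast
  then have M: "\<bar>L (t, u t, p)\<bar> \<le> M" if "t \<in> {a..b}" for t using that by auto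
  let ?I = "\<lambda>t. indicator {a<..<b} t :: real" and ?J = "\<lambda>t. indicator {c<..<d} t :: real"
  have Ig: "integrable lborel (\<lambda>t. ?I t * g t)" by (rule minimizer_integrable)
  have IJ: "?J t * ?I t = ?J t" for t using cd by (auto simp: indicator_def)
  have "integrable lborel (\<lambda>t. ?J t * (?I t * g t))"
    using integrable_real_mult_indicator[OF _ Ig, of "{c<..<d}"] by (simp add: mult.commute)
  then have Jg: "integrable lborel (\<lambda>t. ?J t * g t)" by (simp add: mult.assoc[symmetric] IJ)
  have Jh: "integrable lborel (\<lambda>t. ?J t * h t)"
    by (rule integrable_indicator_mult_bounded[OF h(1), where M = M]) (use h(2) M cd in auto)
  \<comment> \<open>the integrand along the competitor, up to a null set\<close>
  define k where "k t = (if t \<in> {c<..<d} then h t else g t)" for t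
  have k: "k \<in> borel_measurable borel" unfolding k_def using h(1) g(1) by measurable
  have Ik: "(\<lambda>t. ?I t * k t) = (\<lambda>t. ?I t * g t - ?J t * g t + ?J t * h t)"
    using cd by (auto simp: k_def indicator_def)
  have "action L a b u = ereal (\<integral>t. ?I t * k t \<partial>lborel)"
  proof (rule action_eq_integral[OF k, of "N \<union> {c, d}"])
    show "negligible (N \<union> {c, d})" using N by (intro negligible_Un) auto
    show "integrable lborel (\<lambda>t. ?I t * k t)" unfolding Ik using Ig Jg Jh by auto
    show "L (t, u t, vector_derivative u (at t)) = k t" if t: "t \<in> {a<..<b} - (N \<union> {c, d})" for t
    proof (cases "t \<in> {c<..<d}")
      case True
      then show ?thesis using t vector_derivative_replace_affine[of t c d v p] h(2)[of t] by (simp add: u_def k_def)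
    next
      case False
      then have "t \<in> - {c..d}" using t by auto
      then have "(u has_vector_derivative f t) (at t)"
        by (intro has_vector_derivative_transform_within_open[OF vf, of t "- {c..d}"]) (use t in \<open>auto simp: u_def\<close>)
      then show ?thesis
        using vector_derivative_at[of u "f t" t] g(2)[of t] t \<open>t \<in> - {c..d}\<close> by (auto simp: u_def k_def)
    qed
  qed
  moreover have "action L a b v = ereal (\<integral>t. ?I t * g t \<partial>lborel)"
  proof (rule action_eq_integral[OF g(1) N _ Ig])
    show "L (t, v t, vector_derivative v (at t)) = g t" if "t \<in> {a<..<b} - N" for t
      using vector_derivative_at[OF vf[OF that]] g(2)[of t] that by simp
  qed
  moreover have "action L a b v \<le> action L a b u" using min uadm by (simp add: is_minimizer_def)
  ultimately have "(\<integral>t. ?I t * g t \<partial>lborel) \<le> (\<integral>t. ?I t * k t \<partial>lborel)" by simp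
  also have "\<dots> = (\<integral>t. ?I t * g t \<partial>lborel) - (\<integral>t. ?J t * g t \<partial>lborel) + (\<integral>t. ?J t * h t \<partial>lborel)"
    unfolding Ik using Ig Jg Jh by simp
  finally have "(\<integral>t. ?J t * g t \<partial>lborel) \<le> (\<integral>t. ?J t * h t \<partial>lborel)" by simp
  then have "integral {c..d} g \<le> integral {c..d} h"
    using indicator_integral_eq(2)[OF Jg] indicator_integral_eq(2)[OF Jh] by simp
  also have "integral {c..d} h = integral {c..d} (\<lambda>t. L (t, v c + (t - c) *\<^sub>R p, p))"
    by (rule Henstock_Kurzweil_Integration.integral_cong) (use h(2) cd in \<open>simp add: u_def\<close>)
  finally show "integral {c..d} g \<le> integral {c..d} (\<lambda>t. L (t, v c + (t - c) *\<^sub>R p, p))" .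
  show "g integrable_on {c..d}" by (rule indicator_integral_eq(1)[OF Jg])
qed

text \<open>Over \<open>[c, d]\<close>, the affine competitor costs at most \<open>(C + \<epsilon>) * (d - c)\<close>, where \<open>C\<close> is the value of
the frozen integrand at \<open>p\<close>. The minimizer costs at least \<open>(C - \<epsilon>) * (d - c)\<close> plus \<open>2 * \<tau>\<close> times the
measure of the set where its velocity is far from \<open>p\<close>, because the linear term of the subgradient
inequality integrates to zero.\<close>
lemma minimizer_velocity_near_mean:
  assumes t0: "t0 \<in> {a..b}" and vint: "\<And>x. x \<in> {a..b} \<Longrightarrow> v x = v a + integral {a..x} f"
    and R: "1 \<le> R" and \<eta>: "0 < \<eta>"
  obtains \<delta> where "0 < \<delta>"
    "\<And>c d p. \<lbrakk>a \<le> c; c < d; d \<le> b; \<bar>c - t0\<bar> < \<delta>; \<bar>d - t0\<bar> < \<delta>; p = (v d - v c) /\<^sub>R (d - c); norm p \<le> R\<rbrakk>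
      \<Longrightarrow> measure lebesgue {t\<in>{c<..<d}. 1 \<le> norm (f t - p)} \<le> \<eta> * (d - c)"
proof -
  have ac: "abs_continuous_on_interval a b v" using min by (simp add: is_minimizer_def admissible_def)
  have vc: "continuous_on {a..b} v" by (rule abs_continuous_imp_continuous[OF ac])
  define y0 where "y0 = v t0"
  define R' where "R' = max R (max \<bar>t0\<bar> (norm y0))"
  have R': "1 \<le> R'" "R \<le> R'" "\<bar>t0\<bar> \<le> R'" "norm y0 \<le> R'" using R by (auto simp: R'_def)
  define r where "r = inverse R'"
  have r: "0 < r" "r \<le> 1" using R'(1) by (auto simp: r_def inverse_le_1_iff)
  obtain \<tau> where \<tau>: "0 < \<tau>" and SC\<tau>: "\<And>p. norm p \<le> R' \<Longrightarrow> \<exists>\<xi>. is_subgradient (\<lambda>q. L (t0, y0, q)) p \<xi> \<and>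
      (\<forall>q. r \<le> norm (q - p) \<longrightarrow> L (t0, y0, p) + \<xi> \<bullet> (q - p) + 2 * \<tau> \<le> L (t0, y0, q))"
  proof -
    obtain \<tau> where "0 < \<tau>" and *: "\<forall>t\<in>{a..b}. \<forall>y p. max \<bar>t\<bar> (max (norm y) (norm p)) \<le> R' + 1 \<longrightarrow>
        (\<exists>\<xi>. is_subgradient (\<lambda>q. L (t, y, q)) p \<xi> \<and>
             (\<forall>q. norm (q - p) \<ge> inverse R' \<longrightarrow> L (t, y, q) \<ge> L (t, y, p) + \<xi> \<bullet> (q - p) + 2 * \<tau>))"
      using SC R'(1) unfolding strict_convexity_SC_def by blast
    have "max \<bar>t0\<bar> (max (norm y0) (norm p)) \<le> R' + 1" if "norm p \<le> R'" for p :: 'a using R' that by simp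
    with * t0 show thesis using that[OF \<open>0 < \<tau>\<close>] unfolding r_def by blast
  qed
  \<comment> \<open>minimality will give \<open>\<tau> * |A| \<le> \<epsilon> * (d - c)\<close>; stability of the gap needs \<open>\<epsilon> \<le> \<tau>\<close>\<close>
  define \<epsilon> where "\<epsilon> = min \<tau> (\<eta> * \<tau>)"
  have \<epsilon>: "0 < \<epsilon>" "\<epsilon> \<le> \<tau>" "\<epsilon> \<le> \<eta> * \<tau>" using \<tau> \<eta> by (auto simp: \<epsilon>_def)
  \<comment> \<open>velocities within \<open>r \<le> 1\<close> of a mean velocity of norm at most \<open>R'\<close> have norm at most \<open>R' + 1\<close>\<close>
  let ?K = "{a..b} \<times> cball y0 1 \<times> cball (0::'a) (R' + 1)"
  have "compact ?K" by (intro compact_Times) auto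
  moreover have "continuous_on ?K L" by (rule continuous_on_subset[OF L]) auto
  ultimately have "uniformly_continuous_on ?K L" by (rule compact_uniformly_continuous[rotated])
  then obtain \<delta>1 where \<delta>1: "0 < \<delta>1" "\<And>z z'. \<lbrakk>z \<in> ?K; z' \<in> ?K; dist z' z < \<delta>1\<rbrakk> \<Longrightarrow> dist (L z') (L z) < \<epsilon>"
    using \<epsilon>(1) unfolding uniformly_continuous_on_def by meson
  define \<rho> where "\<rho> = min 1 (\<delta>1 / 2)"
  have \<rho>: "0 < \<rho>" using \<delta>1(1) by (simp add: \<rho>_def)
  have close: "\<bar>L (t, y, q) - L (t0, y0, q)\<bar> \<le> \<epsilon>"
    if "t \<in> {a..b}" "\<bar>t - t0\<bar> < \<delta>1 / 2" "y \<in> ball y0 \<rho>" "norm q \<le> R' + 1" for t y q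
  proof -
    have "dist (t, y, q) (t0, y0, q) = norm (t - t0, y - y0, q - q)" by (simp add: dist_norm)
    also have "\<dots> \<le> norm (t - t0) + norm (y - y0, q - q)" by (rule norm_Pair_le)
    also have "norm (y - y0, q - q) \<le> norm (y - y0)" using norm_Pair_le[of "y - y0" "q - q"] by simp
    also have "norm (y - y0) < \<delta>1 / 2" using that(3) by (simp add: \<rho>_def dist_norm norm_minus_commute)
    finally have "dist (t, y, q) (t0, y0, q) < \<delta>1" using that(2) by simp
    then have "dist (L (t, y, q)) (L (t0, y0, q)) < \<epsilon>"
      by (intro \<delta>1(2)) (use that t0 in \<open>auto simp: \<rho>_def\<close>)
    then show ?thesis by (simp add: dist_real_def)
  qed
  obtain \<delta>2 where \<delta>2: "0 < \<delta>2" "\<And>t. \<lbrakk>t \<in> {a..b}; dist t t0 < \<delta>2\<rbrakk> \<Longrightarrow> dist (v t) (v t0) < \<rho>"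
    using vc t0 \<rho> unfolding continuous_on_iff by meson
  define \<delta> where "\<delta> = min \<delta>2 (\<delta>1 / 2)"
  have vball: "v t \<in> ball y0 \<rho>" if "t \<in> {a..b}" "\<bar>t - t0\<bar> < \<delta>" for t
    using \<delta>2(2)[of t] that by (simp add: y0_def \<delta>_def dist_real_def dist_commute)
  have main: "measure lebesgue {t\<in>{c<..<d}. 1 \<le> norm (f t - p)} \<le> \<eta> * (d - c)"
    if cd: "a \<le> c" "c < d" "d \<le> b" and near: "\<bar>c - t0\<bar> < \<delta>" "\<bar>d - t0\<bar> < \<delta>"
      and p: "p = (v d - v c) /\<^sub>R (d - c)" "norm p \<le> R" for c d p
  proof -
    define C where "C = L (t0, y0, p)"
    define A where "A = {t\<in>{c<..<d}. 1 \<le> norm (f t - p)}"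
    have dcp: "(d - c) *\<^sub>R p = v d - v c" using cd by (simp add: p)
    obtain \<xi> where \<xi>: "is_subgradient (\<lambda>q. L (t0, y0, q)) p \<xi>"
      "\<And>q. r \<le> norm (q - p) \<Longrightarrow> L (t0, y0, p) + \<xi> \<bullet> (q - p) + 2 * \<tau> \<le> L (t0, y0, q)"
      using SC\<tau>[of p] p(2) R'(2) by auto
    have t: "t \<in> {a..b}" "\<bar>t - t0\<bar> < \<delta>" if "t \<in> {c..d}" for t using that near cd by auto
    have low: "(C - \<epsilon>) + (\<xi> \<bullet> f t - \<xi> \<bullet> p) + 2 * \<tau> * indicator A t \<le> g t" if "t \<in> {c..d}" for t
    proof -
      have "L (t0, y0, p) + \<xi> \<bullet> (f t - p) - \<epsilon> + (if r \<le> norm (f t - p) then 2 * \<tau> else 0) \<le> L (t, v t, f t)"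
      proof (rule gap_stable_under_perturbation[where \<phi> = "\<lambda>q. L (t, v t, q)", OF r(1) _ \<epsilon>(2) \<xi>(1)])
        show "0 \<le> \<epsilon>" using \<epsilon>(1) by simp
        show "L (t0, y0, p) + \<xi> \<bullet> (q - p) + 2 * \<tau> \<le> L (t0, y0, q)" if "norm (q - p) = r" for q
          using \<xi>(2)[of q] that by simp
        show "\<bar>L (t, v t, q) - L (t0, y0, q)\<bar> \<le> \<epsilon>" if "norm (q - p) \<le> r" for q
        proof (rule close)
          have "norm q \<le> norm p + norm (q - p)" using norm_triangle_ineq[of p "q - p"] by simp
          then show "norm q \<le> R' + 1" using that r p(2) R'(2) by linarith
        qed (use t[OF \<open>t \<in> {c..d}\<close>] vball in \<open>auto simp: \<delta>_def\<close>)
        show "\<exists>\<eta>. is_subgradient (\<lambda>q. L (t, v t, q)) z \<eta>" for z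
          by (rule SC_imp_subgradient[OF SC t(1)[OF that]])
      qed
      moreover have "2 * \<tau> * indicator A t \<le> (if r \<le> norm (f t - p) then 2 * \<tau> else 0)"
        using r(2) \<tau> by (auto simp: A_def indicator_def)
      ultimately show ?thesis using g(2)[OF t(1)[OF that]] by (simp add: C_def inner_diff_right)
    qed
    have "A \<in> sets borel" unfolding A_def using f(1) by measurable
    then have Am: "A \<in> lmeasurable"
      by (intro bounded_set_imp_lmeasurable bounded_subset[of "{c..d}" A]) (auto simp: A_def)
    have "((\<lambda>t. if t \<in> {c..d} then indicat_real A t else 0) has_integral measure lebesgue A) UNIV"
    proof -
      have "(\<lambda>t. if t \<in> {c..d} then indicat_real A t else 0) = indicat_real A"
        by (rule ext) (auto simp: A_def indicator_def)
      then show ?thesis using lmeasurable_iff_indicator_has_integral[of A "measure lebesgue A"] Am by simp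
    qed
    then have IA: "(indicat_real A has_integral measure lebesgue A) {c..d}" by (simp only: has_integral_restrict_UNIV)
    have io: "f integrable_on {x..y}" for x y
      using integrable_on_subinterval[OF integrable_on_lborel[OF f(2)]] by simp
    have "integral {c..d} f = v d - v c"
      using Henstock_Kurzweil_Integration.integral_combine[OF cd(1) _ io, of d] vint[of c] vint[of d] cd
      by (simp add: algebra_simps)
    then have If: "(f has_integral (v d - v c)) {c..d}" using io[of c d] by (metis integrable_integral)
    have I\<xi>: "((\<lambda>t. \<xi> \<bullet> f t) has_integral \<xi> \<bullet> (v d - v c)) {c..d}"
      using has_integral_linear[OF If bounded_linear_inner_right[of \<xi>]] by (simp add: o_def)
    have const: "((\<lambda>t. k) has_integral k * (d - c)) {c..d}" for k :: real
      using has_integral_const_real[of k c d] cd by (simp add: mult.commute)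
    have "((\<lambda>t. (C - \<epsilon>) + (\<xi> \<bullet> f t - \<xi> \<bullet> p) + 2 * \<tau> * indicator A t) has_integral
        (C - \<epsilon>) * (d - c) + (\<xi> \<bullet> (v d - v c) - (\<xi> \<bullet> p) * (d - c)) + 2 * \<tau> * measure lebesgue A) {c..d}"
      by (intro has_integral_add has_integral_diff const I\<xi> has_integral_mult_right IA)
    moreover have "\<xi> \<bullet> (v d - v c) = (\<xi> \<bullet> p) * (d - c)" by (simp add: dcp[symmetric] mult.commute)
    ultimately have I: "((\<lambda>t. (C - \<epsilon>) + (\<xi> \<bullet> f t - \<xi> \<bullet> p) + 2 * \<tau> * indicator A t) has_integral
        (C - \<epsilon>) * (d - c) + 2 * \<tau> * measure lebesgue A) {c..d}" by simp
    have "(C - \<epsilon>) * (d - c) + 2 * \<tau> * measure lebesgue A \<le> integral {c..d} g"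
      by (rule has_integral_le[OF I integrable_integral[OF minimizer_le_affine_on_subinterval(1)[OF cd]] low])
    also have "\<dots> \<le> integral {c..d} (\<lambda>t. L (t, v c + (t - c) *\<^sub>R p, p))"
      unfolding p(1) by (rule minimizer_le_affine_on_subinterval(2)[OF cd])
    also have "\<dots> \<le> integral {c..d} (\<lambda>t. C + \<epsilon>)"
    proof (rule integral_le)
      have "continuous_on {c..d} (\<lambda>t. L (t, v c + (t - c) *\<^sub>R p, p))"
        by (rule continuous_on_compose2[OF L]) (use cd in \<open>auto intro!: continuous_intros\<close>)
      then show "(\<lambda>t. L (t, v c + (t - c) *\<^sub>R p, p)) integrable_on {c..d}" by (rule integrable_continuous_real)
      show "L (t, v c + (t - c) *\<^sub>R p, p) \<le> C + \<epsilon>" if "t \<in> {c..d}" for t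
      proof -
        define s where "s = (t - c) / (d - c)"
        have s: "0 \<le> s" "s \<le> 1" using that cd by (auto simp: s_def)
        have "(t - c) *\<^sub>R p = s *\<^sub>R (v d - v c)" using cd by (simp add: p s_def divide_inverse)
        then have "v c + (t - c) *\<^sub>R p = (1 - s) *\<^sub>R v c + s *\<^sub>R v d" by (simp add: algebra_simps)
        also have "\<dots> \<in> ball y0 \<rho>"
          by (rule convexD_alt[OF convex_ball]) (use vball near cd s in auto)
        finally have "\<bar>L (t, v c + (t - c) *\<^sub>R p, p) - L (t0, y0, p)\<bar> \<le> \<epsilon>"
          by (intro close) (use t[OF that] p(2) R'(2) in \<open>auto simp: \<delta>_def\<close>)
        then show ?thesis by (simp add: C_def abs_le_iff)
      qed
    qed auto
    also have "\<dots> = (C + \<epsilon>) * (d - c)" by (rule integral_unique[OF const])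
    finally have "\<tau> * measure lebesgue A \<le> \<epsilon> * (d - c)" by (simp add: algebra_simps)
    also have "\<dots> \<le> \<eta> * \<tau> * (d - c)" using \<epsilon>(3) cd by (intro mult_right_mono) auto
    finally have "\<tau> * measure lebesgue A \<le> \<tau> * (\<eta> * (d - c))" by (simp add: algebra_simps)
    then show ?thesis using \<tau> by (simp add: A_def)
  qed
  have "0 < \<delta>" using \<delta>1(1) \<delta>2(1) by (simp add: \<delta>_def)
  then show thesis using main by (rule that)
qed

end

section \<open>Sets in the shadow of a continuous function\<close>

lemma measure_Int_Icc_split:
  fixes K :: "real set"
  assumes K: "K \<in> sets lebesgue" and "x \<le> y" "c \<le> x"
  shows "measure lebesgue (K \<inter> {c..y}) = measure lebesgue (K \<inter> {c..x}) + measure lebesgue (K \<inter> {x<..<y})"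
proof -
  have eq: "K \<inter> {c..y} = (K \<inter> {c..x} \<union> K \<inter> {x<..<y}) \<union> (if x < y then K \<inter> {y} else {})"
    using assms by (auto simp: not_less)
  have m1: "K \<inter> {c..x} \<in> lmeasurable" "K \<inter> {x<..<y} \<in> lmeasurable"
    using K by (auto intro!: bounded_set_imp_lmeasurable bounded_Int)
  have "measure lebesgue (K \<inter> {c..y}) = measure lebesgue (K \<inter> {c..x} \<union> K \<inter> {x<..<y})"
  proof (rule measure_negligible_symdiff)
    show "K \<inter> {c..x} \<union> K \<inter> {x<..<y} \<in> lmeasurable" using m1 by auto
    show "negligible (K \<inter> {c..x} \<union> K \<inter> {x<..<y} - K \<inter> {c..y} \<union> (K \<inter> {c..y} - (K \<inter> {c..x} \<union> K \<inter> {x<..<y})))"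
      by (rule negligible_subset[of "{y}"]) (use assms in auto)
  qed
  also have "\<dots> = measure lebesgue (K \<inter> {c..x}) + measure lebesgue (K \<inter> {x<..<y} - K \<inter> {c..x})"
    by (rule measure_Un2[OF m1])
  also have "K \<inter> {x<..<y} - K \<inter> {c..x} = K \<inter> {x<..<y}" by auto
  finally show ?thesis .
qed

text \<open>The classical proof decomposes the shadow into its components, on which \<open>g\<close> takes equal values at the
end points. Here the estimate \<open>|K \<inter> [0, x]| \<le> \<eta> * x\<close> is propagated directly through the points \<open>x\<close>
at which \<open>g\<close> attains its running maximum. Such a point is not in the closed set \<open>K\<close>, so a short interval
to its right is free of \<open>K\<close>; either the running maximum increases within that interval, and the next
record is reached at no cost, or \<open>g\<close> drops and returns to the same level later, and the assumption on
level intervals bridges the drop.\<close>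
lemma shadow_measure_le:
  fixes g :: "real \<Rightarrow> real" and K :: "real set"
  assumes s: "0 < s" and g: "continuous_on {0..s} g" and gs: "g 0 < g s"
    and K: "closed K" "K \<subseteq> {0<..<s}"
    and shadow: "\<And>r. r \<in> K \<Longrightarrow> \<exists>y\<in>{0..<r}. g r < g y"
    and \<eta>: "0 \<le> \<eta>"
    and level: "\<And>c d. \<lbrakk>0 \<le> c; c < d; d \<le> s; g c = g d\<rbrakk> \<Longrightarrow> measure lebesgue (K \<inter> {c<..<d}) \<le> \<eta> * (d - c)"
  shows "measure lebesgue K \<le> \<eta> * s"
proof -
  define h where "h x = measure lebesgue (K \<inter> {0..x}) - \<eta> * x" for x
  \<comment> \<open>the records below the final level, up to which the estimate holds; the largest one is \<open>z\<close>\<close>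
  define T where "T = {x\<in>{0..s}. (\<forall>y\<in>{0..x}. g y \<le> g x) \<and> h x \<le> 0 \<and> g x \<le> g s}"
  have mK: "K \<in> sets lebesgue" using K by auto
  have hdiff: "h y = h x + measure lebesgue (K \<inter> {x<..<y}) - \<eta> * (y - x)" if "0 \<le> x" "x \<le> y" for x y
    using measure_Int_Icc_split[OF mK that(2) that(1)] by (simp add: h_def algebra_simps)
  have "0 \<in> T"
  proof -
    have "K \<inter> {0..0} = {}" using K by auto
    then show ?thesis using s gs by (auto simp: T_def h_def)
  qed
  define z where "z = Sup T"
  have bdd: "bdd_above T" by (rule bdd_aboveI[of _ s]) (auto simp: T_def)
  have Tle: "x \<le> z" if "x \<in> T" for x using cSup_upper[OF that bdd] by (simp add: z_def)
  have z: "z \<in> {0..s}"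
  proof -
    have "z \<le> s" unfolding z_def by (rule cSup_least) (use \<open>0 \<in> T\<close> in \<open>auto simp: T_def\<close>)
    then show ?thesis using Tle[OF \<open>0 \<in> T\<close>] by simp
  qed
  obtain X where X: "\<And>n. X n \<in> T" "X \<longlonglongrightarrow> z"
    using closure_contains_Sup[OF _ bdd] \<open>0 \<in> T\<close> unfolding z_def closure_sequential by blast
  have gX: "(\<lambda>n. g (X n)) \<longlonglongrightarrow> g z"
    by (rule continuous_on_tendsto_compose[OF g X(2) z]) (use X(1) in \<open>auto simp: T_def\<close>)
  have zT: "z \<in> T"
  proof -
    have "g y \<le> g z" if "y \<in> {0..z}" for y
    proof (cases "y = z")
      case False
      then have "y < z" using that by auto
      have "\<forall>\<^sub>F n in sequentially. y < X n" using order_tendstoD(1)[OF X(2) \<open>y < z\<close>] .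
      then have "\<forall>\<^sub>F n in sequentially. g y \<le> g (X n)"
        by eventually_elim (use X(1) that in \<open>auto simp: T_def\<close>)
      then show ?thesis using tendsto_lowerbound[OF gX] by auto
    qed auto
    moreover have "g z \<le> g s"
      using LIMSEQ_le_const2[OF gX] X(1) by (auto simp: T_def)
    moreover have "h z \<le> 0"
    proof -
      have "h z \<le> (z - X n)" for n
      proof -
        have "measure lebesgue (K \<inter> {X n<..<z}) \<le> measure lebesgue {X n<..<z}"
          by (rule measure_mono_fmeasurable) (use mK in auto)
        also have "\<dots> = z - X n" using Tle[OF X(1)[of n]] by simp
        finally have "measure lebesgue (K \<inter> {X n<..<z}) \<le> z - X n" .
        moreover have "0 \<le> \<eta> * (z - X n)" using \<eta> Tle[OF X(1)[of n]] by simp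
        moreover have "h (X n) \<le> 0" "0 \<le> X n" using X(1)[of n] by (auto simp: T_def)
        ultimately show ?thesis using hdiff[of "X n" z] Tle[OF X(1)[of n]] by simp
      qed
      moreover have "(\<lambda>n. z - X n) \<longlonglongrightarrow> z - z" by (intro tendsto_intros X(2))
      ultimately show ?thesis using LIMSEQ_le_const[of "\<lambda>n. z - X n" 0 "h z"] by auto
    qed
    ultimately show ?thesis using z by (auto simp: T_def)
  qed
  have hz: "h z \<le> 0" and rec: "\<And>y. y \<in> {0..z} \<Longrightarrow> g y \<le> g z" using zT by (auto simp: T_def)
  have "g z = g s"
  proof (rule ccontr)
    assume "g z \<noteq> g s"
    then have gz: "g z < g s" using zT by (auto simp: T_def)
    then have "z < s" using z by (cases "z = s") auto
    have "z \<notin> K" using shadow[of z] rec by fastforce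
    then obtain \<delta> where \<delta>: "\<delta> > 0" "\<And>y. dist y z < \<delta> \<Longrightarrow> y \<notin> K"
      using K(1) by (metis ComplD ComplI open_Compl open_dist)
    obtain \<delta>' where \<delta>': "\<delta>' > 0" "\<And>y. \<lbrakk>y \<in> {0..s}; dist y z < \<delta>'\<rbrakk> \<Longrightarrow> dist (g y) (g z) < g s - g z"
      using g z gz unfolding continuous_on_iff by (metis diff_gt_0_iff_gt)
    \<comment> \<open>to the right of \<open>z\<close> and up to \<open>u\<close> there are no points of \<open>K\<close>, and \<open>g\<close> stays below \<open>g s\<close>\<close>
    define u where "u = min s (z + min \<delta> \<delta>' / 2)"
    have u: "z < u" "u \<le> s" "u < z + \<delta>" "u < z + \<delta>'"
      using \<open>z < s\<close> \<delta>(1) \<delta>'(1) by (auto simp: u_def min_def)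
    have cu: "continuous_on {z..u} g" using continuous_on_subset[OF g] z u by auto
    obtain p where p: "p \<in> {z..u}" "\<And>y. y \<in> {z..u} \<Longrightarrow> g y \<le> g p"
      using continuous_attains_sup[OF _ _ cu] u by auto
    show False
    proof (cases "g p > g z")
      case True
      then have "z < p" using p(1) by (cases "p = z") auto
      have "K \<inter> {z<..<p} = {}" using \<delta>(2) p u by (auto simp: dist_real_def)
      then have "h p \<le> 0" using hdiff[of z p] hz \<open>z < p\<close> z \<eta> by auto (smt (verit) mult_nonneg_nonneg)
      moreover have "g p \<le> g s" using \<delta>'(2)[of p] p u z by (auto simp: dist_real_def)
      moreover have "g y \<le> g p" if "y \<in> {0..p}" for y
        using rec[of y] p(2)[of y] that True p(1) by (cases "y \<le> z") auto
      ultimately have "p \<in> T" using p u z by (auto simp: T_def)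
      then show False using Tle \<open>z < p\<close> by force
    next
      case False
      then have low: "g y \<le> g z" if "y \<in> {z..u}" for y using p(2)[OF that] by auto
      \<comment> \<open>the first return of \<open>g\<close> to the level \<open>g z\<close> is a record again\<close>
      define A where "A = {y\<in>{u..s}. g y = g z}"
      have cus: "continuous_on {u..s} g" using continuous_on_subset[OF g] z u by auto
      have "\<exists>y\<ge>u. y \<le> s \<and> g y = g z"
        by (rule IVT'[OF _ _ u(2) cus]) (use low u gz in auto)
      then have "A \<noteq> {}" by (auto simp: A_def)
      moreover have "closed A"
        using continuous_closed_preimage_constant[OF cus] by (auto simp: A_def)
      then have "compact A"
        by (metis A_def bounded_closed_interval bounded_subset compact_eq_bounded_closed mem_Collect_eq subsetI)
      ultimately obtain q where q: "q \<in> A" "\<And>y. y \<in> A \<Longrightarrow> q \<le> y"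
        using compact_attains_inf[of A] by auto
      have qs: "u \<le> q" "q \<le> s" "g q = g z" "z < q" using q u by (auto simp: A_def)
      have "g y \<le> g q" if "y \<in> {0..q}" for y
      proof (rule ccontr)
        assume c: "\<not> g y \<le> g q"
        then have "u < y" using rec[of y] low[of y] that qs by (cases "y \<le> z"; cases "y \<le> u") auto
        have "\<exists>x\<ge>u. x \<le> y \<and> g x = g z"
          by (rule IVT'[OF _ _ _ continuous_on_subset[OF cus]]) (use low[of u] u c qs that \<open>u < y\<close> in auto)
        then obtain x where x: "u \<le> x" "x \<le> y" "g x = g z" by auto
        then have "x \<in> A" using that qs by (auto simp: A_def)
        then have "y = q" using q(2) x that by force
        then show False using c by auto
      qed
      moreover have "h q \<le> h z" using level[of z q] hdiff[of z q] qs z by auto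
      ultimately have "q \<in> T" using qs gz z hz by (auto simp: T_def)
      then show False using Tle \<open>z < q\<close> by force
    qed
  qed
  then have "h s \<le> h z" using level[of z s] hdiff[of z s] z by (cases "z = s") auto
  moreover have "K \<inter> {0..s} = K" using K by auto
  ultimately show ?thesis using hz by (simp add: h_def)
qed

section \<open>Points of infinite derivative\<close>

text \<open>The variable \<open>y = \<theta> * (s - t)\<close> measures the distance from \<open>t\<close> to the right (\<open>\<theta> = 1\<close>) or to the left
(\<open>\<theta> = -1\<close>), and \<open>\<sigma>\<close> is chosen such that \<open>\<sigma> * v\<^sub>k\<close> rises with infinite slope in the variable \<open>y\<close>. In
this form one proof covers both sides and both signs of the infinite derivative.\<close>
lemma infinite_derivative_density_zero:
  fixes a b t \<theta> \<sigma> m :: real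
    and L :: "real \<times> (real ^ 'n) \<times> (real ^ 'n) \<Rightarrow> real"
    and v :: "real \<Rightarrow> real ^ 'n"
    and k :: 'n
  assumes ab: "a < b" and L: "continuous_on ({a..b} \<times> UNIV \<times> UNIV) L"
    and SC: "strict_convexity_SC a b L" and min: "is_minimizer L a b v"
    and \<theta>: "\<theta> = 1 \<or> \<theta> = - 1" and \<sigma>: "\<sigma> = 1 \<or> \<sigma> = - 1"
    and dom: "\<forall>\<^sub>F s in at_right 0. (\<lambda>y. t + \<theta> * y) ` {0..s} \<subseteq> {a..b}"
    and div: "filterlim (\<lambda>y. \<sigma> * (v (t + \<theta> * y) $ k - v t $ k) / y) at_top (at_right 0)"
    and lip: "\<And>j. j \<noteq> k \<Longrightarrow> \<forall>\<^sub>F s in at_right 0. \<exists>C. C-lipschitz_on ((\<lambda>y. t + \<theta> * y) ` {0..s}) (\<lambda>x. v x $ j)"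
    and m: "0 < m"
  shows "((\<lambda>s. inverse s * measure lebesgue
      {r \<in> (\<lambda>y. t + \<theta> * y) ` {0<..<s}. \<bar>deriv (\<lambda>x. v x $ k) r\<bar> \<le> m}) \<longlongrightarrow> 0) (at_right 0)"
proof -
  define \<phi> where "\<phi> y = t + \<theta> * y" for y
  have "\<forall>\<^sub>F s in at_right 0. \<forall>j\<in>- {k}. \<exists>C. C-lipschitz_on (\<phi> ` {0..s}) (\<lambda>x. v x $ j)"
    unfolding \<phi>_def by (rule eventually_ball_finite) (use lip in auto)
  moreover have "\<forall>\<^sub>F s::real in at_right 0. 0 < s" by (rule eventually_at_right_less)
  moreover have "\<forall>\<^sub>F s in at_right 0. \<phi> ` {0..s} \<subseteq> {a..b}" using dom unfolding \<phi>_def .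
  ultimately have "\<forall>\<^sub>F s in at_right 0. 0 < s \<and> \<phi> ` {0..s} \<subseteq> {a..b} \<and>
      (\<forall>j\<in>- {k}. \<exists>C. C-lipschitz_on (\<phi> ` {0..s}) (\<lambda>x. v x $ j))"
    by eventually_elim blast
  then obtain s0 where s0: "0 < s0" "\<phi> ` {0..s0} \<subseteq> {a..b}"
    and lip0: "\<And>j. j \<noteq> k \<Longrightarrow> \<exists>C. C-lipschitz_on (\<phi> ` {0..s0}) (\<lambda>x. v x $ j)"
    by (force dest: eventually_happens'[OF trivial_limit_at_right_real])
  have \<phi>ab: "\<phi> y \<in> {a..b}" if "0 \<le> y" "y \<le> s0" for y using subsetD[OF s0(2), of "\<phi> y"] that by auto
  have \<phi>in: "\<phi> y \<in> {a<..<b}" if "0 < y" "y < s0" for y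
    using \<phi>ab[of 0] \<phi>ab[of s0] that \<theta> by (auto simp: \<phi>_def)
  have \<phi>dist: "\<bar>\<phi> x - \<phi> y\<bar> = \<bar>x - y\<bar>" for x y using \<theta> by (auto simp: \<phi>_def)
  have \<phi>0: "\<phi> 0 = t" by (simp add: \<phi>_def)
  have \<phi>inj: "inj \<phi>" using \<theta> by (auto simp: \<phi>_def inj_def)
  have \<phi>surj: "surj \<phi>" by (rule surjI[of _ "\<lambda>r. \<theta> * (r - t)"]) (use \<theta> in \<open>auto simp: \<phi>_def\<close>)
  have \<phi>meas: "measure lebesgue (\<phi> ` A) = measure lebesgue A" for A
    using measure_lebesgue_affine[of \<theta> t A] \<theta> by (auto simp: \<phi>_def add.commute)
  have \<phi>cont: "continuous_on X \<phi>" for X unfolding \<phi>_def by (intro continuous_intros)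
  have t: "t \<in> {a..b}" using \<phi>ab[of 0] s0(1) \<phi>0 by simp
  have ac: "abs_continuous_on_interval a b v" using min by (simp add: is_minimizer_def admissible_def)
  have vc: "continuous_on {a..b} v" by (rule abs_continuous_imp_continuous[OF ac])
  obtain f N where f: "f \<in> borel_measurable borel" "integrable lborel f"
    and vint: "\<And>x. x \<in> {a..b} \<Longrightarrow> v x = v a + integral {a..x} f"
    and N: "negligible N" and vf: "\<And>x. x \<in> {a<..<b} - N \<Longrightarrow> (v has_vector_derivative f x) (at x)"
    by (rule abs_continuous_eq_integral[OF ac less_imp_le[OF ab]]) (rule that, assumption+)
  obtain g where g: "g \<in> borel_measurable borel" "\<And>t. t \<in> {a..b} \<Longrightarrow> g t = L (t, v t, f t)"
    by (rule integrand_borel_measurable[OF less_imp_le[OF ab] L vc f(1)]) (rule that, assumption+)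
  obtain C where C: "\<And>j. j \<noteq> k \<Longrightarrow> (C j)-lipschitz_on (\<phi> ` {0..s0}) (\<lambda>x. v x $ j)"
    using lip0 by metis
  \<comment> \<open>bounds for the components of the mean velocity on level intervals of \<open>h\<close>\<close>
  define B where "B j = (if j = k then m + 1 else C j)" for j
  define R where "R = max 1 (\<Sum>j\<in>UNIV. B j)"
  have vk: "\<bar>f (\<phi> r) $ k\<bar> \<le> m \<and> ((\<lambda>x. v x $ k) has_real_derivative f (\<phi> r) $ k) (at (\<phi> r))"
    if "0 < r" "r < s0" "\<phi> r \<notin> N" "\<bar>deriv (\<lambda>x. v x $ k) (\<phi> r)\<bar> \<le> m" for r
  proof -
    have "(v has_vector_derivative f (\<phi> r)) (at (\<phi> r))" using vf \<phi>in[OF that(1,2)] that(3) by auto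
    then have "((\<lambda>x. v x $ k) has_vector_derivative f (\<phi> r) $ k) (at (\<phi> r))"
      by (rule bounded_linear.has_vector_derivative[OF bounded_linear_vec_nth])
    then have "((\<lambda>x. v x $ k) has_real_derivative f (\<phi> r) $ k) (at (\<phi> r))"
      by (simp add: has_real_derivative_iff_has_vector_derivative)
    then show ?thesis using DERIV_imp_deriv that(4) by metis
  qed
  have bound: "\<exists>x0>0. \<forall>s. 0 < s \<and> s < x0 \<longrightarrow> measure lebesgue
      {r \<in> \<phi> ` {0<..<s}. \<bar>deriv (\<lambda>x. v x $ k) r\<bar> \<le> m} \<le> \<eta> * s" if "0 < \<eta>" for \<eta>
  proof -
    obtain \<delta> where \<delta>: "0 < \<delta>" and gap: "\<And>c d p. \<lbrakk>a \<le> c; c < d; d \<le> b; \<bar>c - t\<bar> < \<delta>; \<bar>d - t\<bar> < \<delta>;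
        p = (v d - v c) /\<^sub>R (d - c); norm p \<le> R\<rbrakk>
        \<Longrightarrow> measure lebesgue {t\<in>{c<..<d}. 1 \<le> norm (f t - p)} \<le> \<eta> * (d - c)"
      by (rule minimizer_velocity_near_mean[OF ab L SC min f N vf g t vint _ \<open>0 < \<eta>\<close>, of R])
        (assumption+, simp add: R_def, rule that, assumption+)
    have "\<forall>\<^sub>F y in at_right 0. m + 1 < \<sigma> * (v (\<phi> y) $ k - v t $ k) / y"
      using div unfolding \<phi>_def filterlim_at_top_dense by blast
    then obtain x1 where x1: "0 < x1" "\<And>y. \<lbrakk>0 < y; y < x1\<rbrakk> \<Longrightarrow> m + 1 < \<sigma> * (v (\<phi> y) $ k - v t $ k) / y"
      unfolding eventually_at_right_field by auto
    define x0 where "x0 = min x1 (min \<delta> s0)"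
    have "measure lebesgue {r \<in> \<phi> ` {0<..<s}. \<bar>deriv (\<lambda>x. v x $ k) r\<bar> \<le> m} \<le> \<eta> * s"
      if s: "0 < s" "s < x0" for s
    proof -
      define E where "E = {r \<in> \<phi> ` {0<..<s}. \<bar>deriv (\<lambda>x. v x $ k) r\<bar> \<le> m}"
      define h where "h y = \<sigma> * (v (\<phi> y) $ k - v t $ k) - (m + 1) * y" for y
      have hc: "continuous_on {0..s} h"
        unfolding h_def
        by (intro continuous_intros continuous_on_compose2[OF vc \<phi>cont]) (use \<phi>ab s in \<open>auto simp: x0_def\<close>)
      have h0: "h 0 = 0" by (simp add: h_def \<phi>0)
      have hs: "h 0 < h s" using x1(2)[of s] s by (simp add: h0 x0_def, simp add: h_def field_simps)
      \<comment> \<open>\<open>E - N\<close> is exhausted by closed subsets, as the shadow estimate needs closed sets\<close>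
      have closed_le: "measure lebesgue K \<le> \<eta> * s" if K: "closed K" "K \<subseteq> E - N" for K
      proof -
        define K' where "K' = \<phi> -` K"
        have KK': "K = \<phi> ` K'" using \<phi>surj by (simp add: K'_def surj_image_vimage_eq)
        have K': "r \<in> {0<..<s} \<and> \<phi> r \<notin> N \<and> \<bar>deriv (\<lambda>x. v x $ k) (\<phi> r)\<bar> \<le> m" if "r \<in> K'" for r
        proof -
          have "\<phi> r \<in> E - N" using that K(2) by (auto simp: K'_def)
          then show ?thesis unfolding E_def by (simp add: inj_image_mem_iff[OF \<phi>inj])
        qed
        have "measure lebesgue K' \<le> \<eta> * s"
        proof (rule shadow_measure_le[OF s(1) hc hs])
          show "closed K'" unfolding K'_def by (rule closed_vimage[OF K(1)]) (use \<phi>cont in simp)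
          show "K' \<subseteq> {0<..<s}" using K' by auto
          show "0 \<le> \<eta>" using \<open>0 < \<eta>\<close> by simp
          show "\<exists>y\<in>{0..<r}. h r < h y" if "r \<in> K'" for r
          proof -
            have r: "0 < r" "r < s0" using K'[OF that] s by (auto simp: x0_def)
            have d: "\<bar>f (\<phi> r) $ k\<bar> \<le> m" "((\<lambda>x. v x $ k) has_real_derivative f (\<phi> r) $ k) (at (\<phi> r))"
              using vk[OF r] K'[OF that] by auto
            have "(\<phi> has_real_derivative \<theta>) (at r)" unfolding \<phi>_def by (auto intro!: derivative_eq_intros)
            from DERIV_chain2[OF d(2) this]
            have "(h has_real_derivative \<sigma> * (f (\<phi> r) $ k * \<theta>) - (m + 1)) (at r)"
              unfolding h_def by (auto intro!: derivative_eq_intros)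
            moreover have "\<sigma> * (f (\<phi> r) $ k * \<theta>) - (m + 1) < 0" using d(1) \<theta> \<sigma> by (auto simp: abs_le_iff)
            ultimately obtain e where e: "0 < e" "\<And>y. \<lbrakk>0 < y; y < e\<rbrakk> \<Longrightarrow> h r < h (r - y)"
              using DERIV_neg_dec_left by blast
            have "h r < h (r - min (e / 2) (r / 2))" using e r by (intro e(2)) auto
            then show ?thesis using e(1) r by (intro bexI[of _ "r - min (e / 2) (r / 2)"]) auto
          qed
          show "measure lebesgue (K' \<inter> {c<..<d}) \<le> \<eta> * (d - c)"
            if cd: "0 \<le> c" "c < d" "d \<le> s" "h c = h d" for c d
          proof -
            define c' d' where "c' = min (\<phi> c) (\<phi> d)" and "d' = max (\<phi> c) (\<phi> d)"
            define p where "p = (v d' - v c') /\<^sub>R (d' - c')"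
            have cds: "c \<in> {0..s0}" "d \<in> {0..s0}" using cd s by (auto simp: x0_def)
            have len: "d' - c' = d - c" using \<phi>dist[of c d] cd(2) by (simp add: c'_def d'_def min_def max_def abs_if split: if_splits)
            have comp: "\<bar>p $ j\<bar> = \<bar>v (\<phi> d) $ j - v (\<phi> c) $ j\<bar> / (d - c)" for j
              using len cd(2) by (auto simp: p_def c'_def d'_def min_def max_def abs_mult divide_inverse abs_minus_commute)
            have "\<sigma> * (v (\<phi> d) $ k - v (\<phi> c) $ k) = (m + 1) * (d - c)"
              using cd(4) by (simp add: h_def algebra_simps)
            then have "\<bar>\<sigma> * (v (\<phi> d) $ k - v (\<phi> c) $ k)\<bar> = (m + 1) * (d - c)"
              using cd(2) m by (simp add: abs_mult)
            then have pk: "\<bar>p $ k\<bar> = m + 1" using comp[of k] \<sigma> cd(2) by (auto simp: abs_mult)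
            have pj: "\<bar>p $ j\<bar> \<le> B j" for j
            proof (cases "j = k")
              case False
              have "\<bar>v (\<phi> d) $ j - v (\<phi> c) $ j\<bar> \<le> C j * (d - c)"
                using lipschitz_onD[OF C[OF False], of "\<phi> d" "\<phi> c"] cds cd(2) \<phi>dist[of d c] by (simp add: dist_real_def)
              then show ?thesis unfolding comp[of j] using cd(2) False by (simp add: B_def pos_divide_le_eq)
            qed (simp add: pk B_def)
            have "norm p \<le> (\<Sum>j\<in>UNIV. \<bar>p $ j\<bar>)" by (rule norm_le_l1_cart)
            also have "\<dots> \<le> (\<Sum>j\<in>UNIV. B j)" by (intro sum_mono pj)
            finally have "norm p \<le> R" by (simp add: R_def)
            have near: "\<bar>\<phi> c - t\<bar> < \<delta>" "\<bar>\<phi> d - t\<bar> < \<delta>"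
              using \<phi>dist[of c 0] \<phi>dist[of d 0] \<phi>0 cd s by (auto simp: x0_def)
            have "\<phi> ` (K' \<inter> {c<..<d}) \<subseteq> {t\<in>{c'<..<d'}. 1 \<le> norm (f t - p)}"
            proof (rule image_subsetI)
              fix r assume r: "r \<in> K' \<inter> {c<..<d}"
              then have "\<bar>f (\<phi> r) $ k\<bar> \<le> m" using vk[of r] K'[of r] s by (auto simp: x0_def)
              then have "1 \<le> \<bar>(f (\<phi> r) - p) $ k\<bar>" using pk by (simp add: abs_if split: if_splits)
              also have "\<dots> \<le> norm (f (\<phi> r) - p)" by (rule component_le_norm_cart)
              finally show "\<phi> r \<in> {t\<in>{c'<..<d'}. 1 \<le> norm (f t - p)}"
                using r \<theta> by (auto simp: c'_def d'_def \<phi>_def)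
            qed
            then have "measure lebesgue (\<phi> ` (K' \<inter> {c<..<d})) \<le> measure lebesgue {t\<in>{c'<..<d'}. 1 \<le> norm (f t - p)}"
            proof (rule measure_mono_fmeasurable)
              have "\<phi> ` (K' \<inter> {c<..<d}) = K \<inter> \<phi> ` {c<..<d}" unfolding KK' using \<phi>inj by (simp add: image_Int)
              also have "\<phi> ` {c<..<d} = {c'<..<d'}"
              proof -
                have "r \<in> \<phi> ` {c<..<d}" if "r \<in> {c'<..<d'}" for r
                  by (rule image_eqI[of _ _ "\<theta> * (r - t)"]) (use that \<theta> cd(2) in \<open>auto simp: \<phi>_def c'_def d'_def\<close>)
                then show ?thesis using \<theta> by (auto simp: \<phi>_def c'_def d'_def)
              qed
              finally show "\<phi> ` (K' \<inter> {c<..<d}) \<in> sets lebesgue" using K(1) by auto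
              have "{t\<in>{c'<..<d'}. 1 \<le> norm (f t - p)} \<in> sets borel" using f(1) by measurable
              then show "{t\<in>{c'<..<d'}. 1 \<le> norm (f t - p)} \<in> lmeasurable"
                by (intro bounded_set_imp_lmeasurable bounded_subset[OF bounded_closed_interval[of c' d']]) auto
            qed
            also have "\<dots> \<le> \<eta> * (d' - c')"
              by (rule gap[OF _ _ _ _ _ p_def \<open>norm p \<le> R\<close>])
                (use \<phi>ab[of c] \<phi>ab[of d] cds near len cd(2) in \<open>auto simp: c'_def d'_def min_def max_def\<close>)
            finally show ?thesis using \<phi>meas[of "K' \<inter> {c<..<d}"] len by simp
          qed
        qed
        then show ?thesis using \<phi>meas[of K'] KK' by simp
      qed
      show ?thesis
      proof (cases "E \<in> sets lebesgue")
        case False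
        \<comment> \<open>\<open>measure\<close> vanishes on sets that are not measurable\<close>
        then have "measure lebesgue E = 0" by (rule measure_notin_sets)
        then show ?thesis using s \<open>0 < \<eta>\<close> by (simp add: E_def)
      next
        case True
        have "bounded (\<phi> ` {0<..<s})"
          by (rule bounded_subset[OF compact_imp_bounded[OF compact_continuous_image[OF \<phi>cont compact_Icc[of 0 s]]]]) auto
        then have "bounded E" by (rule bounded_subset) (auto simp: E_def)
        then have Em: "E \<in> lmeasurable" using True by (intro bounded_set_imp_lmeasurable)
        have ENm: "E - N \<in> lmeasurable" using Em negligible_imp_measurable[OF N] by (rule fmeasurable.Diff)
        have "measure lebesgue E = measure lebesgue (E - N)"
          by (rule measure_negligible_symdiff[OF ENm]) (rule negligible_subset[OF N], auto)
        also have "\<dots> \<le> \<eta> * s"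
        proof (rule field_le_epsilon)
          fix e :: real assume "0 < e"
          obtain K where K: "closed K" "K \<subseteq> E - N" "E - N - K \<in> lmeasurable" "emeasure lebesgue (E - N - K) < ennreal e"
            using sets_lebesgue_inner_closed[OF fmeasurableD[OF ENm] \<open>0 < e\<close>] by blast
          have Km: "K \<in> lmeasurable"
            using K(1) bounded_subset[OF \<open>bounded E\<close>, of K] K(2) by (intro bounded_set_imp_lmeasurable) auto
          have "measure lebesgue (E - N) = measure lebesgue (K \<union> (E - N))" using K(2) by (simp add: Un_absorb1)
          also have "\<dots> = measure lebesgue K + measure lebesgue (E - N - K)" by (rule measure_Un2[OF Km ENm])
          also have "measure lebesgue (E - N - K) < e"
            using K(3,4) \<open>0 < e\<close> by (simp add: emeasure_eq_measure2 ennreal_less_iff)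
          finally show "measure lebesgue (E - N) \<le> \<eta> * s + e" using closed_le[OF K(1,2)] by linarith
        qed
        finally show ?thesis by (simp add: E_def)
      qed
    qed
    moreover have "0 < x0" using x1(1) \<delta> s0(1) by (simp add: x0_def)
    ultimately show ?thesis by blast
  qed
  show ?thesis
  proof (rule tendstoI)
    fix e :: real assume "0 < e"
    then obtain x0 where x0: "0 < x0" "\<And>s. \<lbrakk>0 < s; s < x0\<rbrakk> \<Longrightarrow> measure lebesgue
      {r \<in> \<phi> ` {0<..<s}. \<bar>deriv (\<lambda>x. v x $ k) r\<bar> \<le> m} \<le> e / 2 * s" using bound[of "e / 2"] by auto
    have "dist (inverse s * measure lebesgue {r \<in> \<phi> ` {0<..<s}. \<bar>deriv (\<lambda>x. v x $ k) r\<bar> \<le> m}) 0 < e"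
      if "0 < s" "s < x0" for s
    proof -
      have "inverse s * measure lebesgue {r \<in> \<phi> ` {0<..<s}. \<bar>deriv (\<lambda>x. v x $ k) r\<bar> \<le> m} \<le> inverse s * (e / 2 * s)"
        by (rule mult_left_mono[OF x0(2)[OF that]]) (use that in simp)
      also have "\<dots> < e" using that \<open>0 < e\<close> by simp
      finally show ?thesis using that by (simp add: dist_real_def)
    qed
    then show "\<forall>\<^sub>F s in at_right 0. dist (inverse s * measure lebesgue
      {r \<in> (\<lambda>y. t + \<theta> * y) ` {0<..<s}. \<bar>deriv (\<lambda>x. v x $ k) r\<bar> \<le> m}) 0 < e"
      unfolding eventually_at_right_field \<phi>_def[symmetric] using x0(1) by (intro exI[of _ x0]) auto
  qed
qed

lemma infinite_limit_imp_at_top: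
  assumes "\<bar>D\<bar> = \<infinity>" and lim: "((\<lambda>s. ereal (q s)) \<longlongrightarrow> D) F"
  obtains \<sigma> :: real where "\<sigma> = 1 \<or> \<sigma> = - 1" "filterlim (\<lambda>s. \<sigma> * q s) at_top F"
proof -
  consider "D = \<infinity>" | "D = - \<infinity>" using assms(1) by (cases D) auto
  then show thesis
  proof cases
    case 1
    then show thesis using that[of 1] lim by (simp add: tendsto_PInfty_eq_at_top)
  next
    case 2
    have "((\<lambda>s. ereal (- q s)) \<longlongrightarrow> \<infinity>) F" using tendsto_uminus_ereal[OF lim] 2 by simp
    then show thesis using that[of "- 1"] by (simp add: tendsto_PInfty_eq_at_top)
  qed
qed

lemma filterlim_at_left_eq_at_right_0:
  "filterlim f F (at_left t) \<longleftrightarrow> filterlim (\<lambda>y. f (t - y)) F (at_right (0::real))"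
  unfolding filterlim_at_left_to_right filterlim_at_right_to_0[of _ _ "- t"] by simp

lemma filterlim_at_right_eq_at_right_0:
  "filterlim f F (at_right t) \<longleftrightarrow> filterlim (\<lambda>y. f (t + y)) F (at_right (0::real))"
  unfolding filterlim_at_right_to_0[of _ _ t] by (simp add: add.commute)

theorem theorem28:
  fixes a b t :: real
    and L :: "real \<times> (real ^ 'n) \<times> (real ^ 'n) \<Rightarrow> real"
    and v :: "real \<Rightarrow> real ^ 'n"
    and k :: 'n
  assumes "a < b"
    and "continuous_on ({a..b} \<times> UNIV \<times> UNIV) L"
    and "strict_convexity_SC a b L"
    and "is_minimizer L a b v"
    and "t \<in> {a..b}"
  shows
    "(t \<in> {a<..b} \<and>
      (\<exists>D. \<bar>D\<bar> = \<infinity> \<and> has_left_derivative (\<lambda>s. v s $ k) D t) \<and>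
      (\<forall>j. j \<noteq> k \<longrightarrow> lipschitz_left_near a b (\<lambda>s. v s $ j) t) \<longrightarrow>
      (\<forall>m>0. ((\<lambda>s. inverse (t - s) *
                 measure lebesgue {r \<in> {s<..<t}. \<bar>deriv (\<lambda>x. v x $ k) r\<bar> \<le> m})
              \<longlongrightarrow> 0) (at_left t)))
     \<and>
     (t \<in> {a..<b} \<and>
      (\<exists>D. \<bar>D\<bar> = \<infinity> \<and> has_right_derivative (\<lambda>s. v s $ k) D t) \<and>
      (\<forall>j. j \<noteq> k \<longrightarrow> lipschitz_right_near a b (\<lambda>s. v s $ j) t) \<longrightarrow>
      (\<forall>m>0. ((\<lambda>s. inverse (s - t) *
                 measure lebesgue {r \<in> {t<..<s}. \<bar>deriv (\<lambda>x. v x $ k) r\<bar> \<le> m})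
              \<longlongrightarrow> 0) (at_right t)))"
proof (intro conjI impI allI; (elim conjE exE)?)
  fix m D assume m: "(0::real) < m" and t: "t \<in> {a<..b}" and D: "\<bar>D\<bar> = \<infinity>"
    and left: "has_left_derivative (\<lambda>s. v s $ k) D t"
    and lip: "\<forall>j. j \<noteq> k \<longrightarrow> lipschitz_left_near a b (\<lambda>s. v s $ j) t"
  have img: "(\<lambda>y. t + (- 1) * y) ` {0..s} = {t - s..t}" "(\<lambda>y. t + (- 1) * y) ` {0<..<s} = {t - s<..<t}" for s
  proof -
    have mem: "x \<in> (\<lambda>y. t + (- 1) * y) ` X \<longleftrightarrow> t - x \<in> X" for x X
      by (auto simp: image_iff intro!: bexI[of _ "t - x"])
    show "(\<lambda>y. t + (- 1) * y) ` {0..s} = {t - s..t}" "(\<lambda>y. t + (- 1) * y) ` {0<..<s} = {t - s<..<t}"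
      by (rule set_eqI, unfold mem, force)+
  qed
  obtain \<sigma> :: real where \<sigma>: "\<sigma> = 1 \<or> \<sigma> = - 1" "filterlim (\<lambda>s. \<sigma> * ((v s $ k - v t $ k) / (s - t))) at_top (at_left t)"
    using left unfolding has_left_derivative_def by (rule infinite_limit_imp_at_top[OF D])
  \<comment> \<open>at the left of \<open>t\<close> the denominator \<open>s - t = - y\<close> reverses the sign\<close>
  have div: "filterlim (\<lambda>y. (- \<sigma>) * (v (t + (- 1) * y) $ k - v t $ k) / y) at_top (at_right 0)"
    using \<sigma>(2) unfolding filterlim_at_left_eq_at_right_0[of _ _ t] by simp
  have ev: "\<forall>\<^sub>F s in at_right 0. {t - s..t} \<subseteq> {t - \<delta>..t} \<inter> {a..b}" if "0 < \<delta>" for \<delta>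
    unfolding eventually_at_right_field using t that by (intro exI[of _ "min \<delta> (t - a)"]) auto
  have "((\<lambda>s. inverse s * measure lebesgue
      {r \<in> (\<lambda>y. t + (- 1) * y) ` {0<..<s}. \<bar>deriv (\<lambda>x. v x $ k) r\<bar> \<le> m}) \<longlongrightarrow> 0) (at_right 0)"
  proof (rule infinite_derivative_density_zero[OF assms(1-4) _ _ _ div _ m])
    show "\<forall>\<^sub>F s in at_right 0. (\<lambda>y. t + (- 1) * y) ` {0..s} \<subseteq> {a..b}"
      unfolding img using ev[of 1] by (auto elim: eventually_mono)
    show "\<forall>\<^sub>F s in at_right 0. \<exists>C. C-lipschitz_on ((\<lambda>y. t + (- 1) * y) ` {0..s}) (\<lambda>x. v x $ j)" if j: "j \<noteq> k" for j
    proof -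
      obtain \<delta> C where "0 < \<delta>" and C: "C-lipschitz_on ({t - \<delta>..t} \<inter> {a..b}) (\<lambda>x. v x $ j)"
        using lip j unfolding lipschitz_left_near_def by blast
      from ev[OF this(1)] show ?thesis unfolding img
        by eventually_elim (use C lipschitz_on_subset in blast)
    qed
  qed (use \<sigma>(1) in auto)
  then show "((\<lambda>s. inverse (t - s) * measure lebesgue {r \<in> {s<..<t}. \<bar>deriv (\<lambda>x. v x $ k) r\<bar> \<le> m}) \<longlongrightarrow> 0) (at_left t)"
    unfolding img by (subst filterlim_at_left_eq_at_right_0) simp
next
  fix m D assume m: "(0::real) < m" and t: "t \<in> {a..<b}" and D: "\<bar>D\<bar> = \<infinity>"
    and right: "has_right_derivative (\<lambda>s. v s $ k) D t"
    and lip: "\<forall>j. j \<noteq> k \<longrightarrow> lipschitz_right_near a b (\<lambda>s. v s $ j) t"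
  have img: "(\<lambda>y. t + 1 * y) ` {0..s} = {t..t + s}" "(\<lambda>y. t + 1 * y) ` {0<..<s} = {t<..<t + s}" for s
  proof -
    have mem: "x \<in> (\<lambda>y. t + 1 * y) ` X \<longleftrightarrow> x - t \<in> X" for x X
      by (auto simp: image_iff intro!: bexI[of _ "x - t"])
    show "(\<lambda>y. t + 1 * y) ` {0..s} = {t..t + s}" "(\<lambda>y. t + 1 * y) ` {0<..<s} = {t<..<t + s}"
      by (rule set_eqI, unfold mem, force)+
  qed
  obtain \<sigma> :: real where \<sigma>: "\<sigma> = 1 \<or> \<sigma> = - 1" "filterlim (\<lambda>s. \<sigma> * ((v s $ k - v t $ k) / (s - t))) at_top (at_right t)"
    using right unfolding has_right_derivative_def by (rule infinite_limit_imp_at_top[OF D])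
  have div: "filterlim (\<lambda>y. \<sigma> * (v (t + 1 * y) $ k - v t $ k) / y) at_top (at_right 0)"
    using \<sigma>(2) by (subst (asm) filterlim_at_right_eq_at_right_0) simp
  have ev: "\<forall>\<^sub>F s in at_right 0. {t..t + s} \<subseteq> {t..t + \<delta>} \<inter> {a..b}" if "0 < \<delta>" for \<delta>
    unfolding eventually_at_right_field using t that by (intro exI[of _ "min \<delta> (b - t)"]) auto
  have "((\<lambda>s. inverse s * measure lebesgue
      {r \<in> (\<lambda>y. t + 1 * y) ` {0<..<s}. \<bar>deriv (\<lambda>x. v x $ k) r\<bar> \<le> m}) \<longlongrightarrow> 0) (at_right 0)"
  proof (rule infinite_derivative_density_zero[OF assms(1-4) _ \<sigma>(1) _ div _ m])
    show "\<forall>\<^sub>F s in at_right 0. (\<lambda>y. t + 1 * y) ` {0..s} \<subseteq> {a..b}"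
      unfolding img using ev[of 1] by (auto elim: eventually_mono)
    show "\<forall>\<^sub>F s in at_right 0. \<exists>C. C-lipschitz_on ((\<lambda>y. t + 1 * y) ` {0..s}) (\<lambda>x. v x $ j)" if j: "j \<noteq> k" for j
    proof -
      obtain \<delta> C where "0 < \<delta>" and C: "C-lipschitz_on ({t..t + \<delta>} \<inter> {a..b}) (\<lambda>x. v x $ j)"
        using lip j unfolding lipschitz_right_near_def by blast
      from ev[OF this(1)] show ?thesis unfolding img
        by eventually_elim (use C lipschitz_on_subset in blast)
    qed
  qed auto
  then show "((\<lambda>s. inverse (s - t) * measure lebesgue {r \<in> {t<..<s}. \<bar>deriv (\<lambda>x. v x $ k) r\<bar> \<le> m}) \<longlongrightarrow> 0) (at_right t)"
    unfolding img by (subst filterlim_at_right_eq_at_right_0) simp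
qed

end
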